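(* Let $G$ be a simple graph of positive size $s$ satisfying $\operatorname{FR}_{\min}(G)=\mathcal E(G)/\sqrt{2s}$. Then there is a positive integer $v$ such that every connected component $C$ of $G$ is of one of the following two types: (i) $C$ is nonbipartite and has $v$ vertices; (ii) $C$ is bipartite, has $2v$ vertices, and its two bipartition classes both have $v$ vertices.
   Context: Graphs are finite, simple and undirected. A vertex labeling of a graph $G=(V,E)$ of order $N=|V|$ is a bijection $\sigma:V\to\mathbb Z_N=\mathbb Z/N\mathbb Z$. The adjacency matrix under $\sigma$ is the $N\times N$ matrix $A_\sigma$, indexed by $\mathbb Z_N\times\mathbb Z_N$, with $(A_\sigma)_{x,y}=1$ if the vertices labeled $x$ and $y$ are adjacent and $0$ otherwise. $F$ is the unitary Fourier matrix $F_{mx}=\frac1{\sqrt N}e^{-2\pi i mx/N}$. The Fourier ratio of a nonzero $N\times N$ matrix $M$ is $\operatorname{FR}(M)=\|FMF\|_1/\|FMF\|_2$, where $\|\cdot\|_1$ is the entrywise $\ell^1$-norm and $\|\cdot\|_2$ the Frobenius norm. The edge complexity is $\operatorname{FR}_{\min}(G)=\min_\sigma\operatorname{FR}(A_\sigma)$, the minimum over all vertex labelings. The size $s$ is the number of edges, and the graph energy $\mathcal E(G)$ is the sum of the absolute values of the adjacency eigenvalues counted with multiplicity. *)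

theory Defs
  imports
    Complex_Main
    "Jordan_Normal_Form.Spectral_Radius"
    "Graph_Theory.Digraph_Component"
begin

text \<open>
  A finite simple graph is a digraph satisfying \<^locale>\<open>graph\<close>: finite, loop-free, symmetric and
  without parallel arcs. An undirected edge is represented by its two opposite arcs, so the size
  counts unordered pairs of end vertices and not arcs.
\<close>

definition graph_size :: "('a, 'b) pre_digraph \<Rightarrow> nat" where
  "graph_size G = card ((\<lambda>e. {tail G e, head G e}) ` arcs G)"

definition bipartition :: "('a, 'b) pre_digraph \<Rightarrow> 'a set \<Rightarrow> 'a set \<Rightarrow> bool" where
  "bipartition G X Y \<longleftrightarrow> X \<union> Y = verts G \<and> X \<inter> Y = {} \<and>
     (\<forall>u v. u \<rightarrow>\<^bsub>G\<^esub> v \<longrightarrow> (u \<in> X \<and> v \<in> Y) \<or> (u \<in> Y \<and> v \<in> X))"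

definition bipartite :: "('a, 'b) pre_digraph \<Rightarrow> bool" where
  "bipartite G \<longleftrightarrow> (\<exists>X Y. bipartition G X Y)"

definition connected_component :: "('a, 'b) pre_digraph \<Rightarrow> ('a, 'b) pre_digraph \<Rightarrow> bool" where
  "connected_component G C \<longleftrightarrow> pre_digraph.max_subgraph G Digraph_Component.connected C"

text \<open>
  The residues modulo \<open>N\<close> are represented by \<open>0, \<dots>, N - 1\<close>, which are also the row and column
  indices of an \<open>N \<times> N\<close> matrix.
\<close>

definition labelings :: "('a, 'b) pre_digraph \<Rightarrow> ('a \<Rightarrow> nat) set" where
  "labelings G = {\<sigma>. bij_betw \<sigma> (verts G) {..<card (verts G)}}"

definition adj_matrix :: "('a, 'b) pre_digraph \<Rightarrow> ('a \<Rightarrow> nat) \<Rightarrow> complex mat" where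
  "adj_matrix G \<sigma> = mat (card (verts G)) (card (verts G))
     (\<lambda>(x, y). if \<exists>u v. \<sigma> u = x \<and> \<sigma> v = y \<and> u \<rightarrow>\<^bsub>G\<^esub> v then 1 else 0)"

definition fourier_matrix :: "nat \<Rightarrow> complex mat" where
  "fourier_matrix N = mat N N (\<lambda>(m, x).
     complex_of_real (1 / sqrt (real N)) *
     exp (- (2 * complex_of_real pi * \<i> * of_nat m * of_nat x / of_nat N)))"

definition l1_norm_mat :: "complex mat \<Rightarrow> real" where
  "l1_norm_mat M = (\<Sum>i<dim_row M. \<Sum>j<dim_col M. cmod (M $$ (i, j)))"

definition frobenius_norm :: "complex mat \<Rightarrow> real" where
  "frobenius_norm M = sqrt (\<Sum>i<dim_row M. \<Sum>j<dim_col M. (cmod (M $$ (i, j)))\<^sup>2)"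

definition fourier_ratio :: "complex mat \<Rightarrow> real" where
  "fourier_ratio M =
     (let F = fourier_matrix (dim_row M)
      in l1_norm_mat (F * M * F) / frobenius_norm (F * M * F))"

text \<open>
  A labeling is an arbitrary function outside \<open>verts G\<close>, so \<^term>\<open>labelings G\<close> itself may be
  infinite. The set of values over which the minimum is taken is nevertheless finite, and
  it is nonempty for finite \<open>G\<close> (lemmas below).
\<close>

definition edge_complexity :: "('a, 'b) pre_digraph \<Rightarrow> real" where
  "edge_complexity G = Min ((\<lambda>\<sigma>. fourier_ratio (adj_matrix G \<sigma>)) ` labelings G)"

lemma labelings_nonempty:
  assumes "finite (verts G)"
  shows "labelings G \<noteq> {}"
  using ex_bij_betw_finite_nat[OF assms] by (auto simp: labelings_def atLeast0LessThan)

lemma finite_adj_matrices: "finite (adj_matrix G ` labelings G)"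
proof (rule finite_subset)
  let ?n = "card (verts G)"
  let ?I = "{..<?n} \<times> {..<?n}"
  let ?f = "\<lambda>S. mat ?n ?n (\<lambda>p. if p \<in> S then 1 else 0 :: complex)"
  show "finite (?f ` Pow ?I)" by simp
  show "adj_matrix G ` labelings G \<subseteq> ?f ` Pow ?I"
  proof
    fix A assume "A \<in> adj_matrix G ` labelings G"
    then obtain \<sigma> where A: "A = adj_matrix G \<sigma>" by blast
    define S where "S = {(x, y) \<in> ?I. \<exists>u v. \<sigma> u = x \<and> \<sigma> v = y \<and> u \<rightarrow>\<^bsub>G\<^esub> v}"
    have "A = ?f S" unfolding A adj_matrix_def S_def by (rule eq_matI) auto
    moreover have "S \<in> Pow ?I" by (auto simp: S_def)
    ultimately show "A \<in> ?f ` Pow ?I" by blast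
  qed
qed

lemma finite_fourier_ratios: "finite ((\<lambda>\<sigma>. fourier_ratio (adj_matrix G \<sigma>)) ` labelings G)"
  using finite_imageI[OF finite_adj_matrices, of fourier_ratio G] by (simp add: image_image)

text \<open>
  \<^term>\<open>order \<mu> (char_poly A)\<close> is the algebraic multiplicity of the eigenvalue \<open>\<mu>\<close>; for the real
  symmetric adjacency matrices it equals the geometric one. The eigenvalues do not depend on the
  labeling, as different labelings give permutation-similar matrices, so any labeling may be chosen.
\<close>

definition matrix_energy :: "complex mat \<Rightarrow> real" where
  "matrix_energy A = (\<Sum>\<mu>\<in>spectrum A. real (order \<mu> (char_poly A)) * cmod \<mu>)"

definition graph_energy :: "('a, 'b) pre_digraph \<Rightarrow> real" where
  "graph_energy G = matrix_energy (adj_matrix G (SOME \<sigma>. \<sigma> \<in> labelings G))"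

end

theory Submission
  imports Defs "Jordan_Normal_Form.Jordan_Normal_Form_Uniqueness"
begin

text \<open>
  Let \<open>A\<close> be the adjacency matrix of an optimal labeling and \<open>M = F * A * F\<close>. With \<open>U\<close> the
  Hermitian unitary sign of \<open>A\<close>, the energy is the trace of \<open>U * A\<close>, hence of \<open>W * M\<close> for the unitary
  matrix \<open>W\<close> obtained by conjugating \<open>U\<close> with \<open>F\<close>. As the entries of \<open>W\<close> have modulus at most 1, the
  energy is at most the entrywise 1-norm of \<open>M\<close>, and equality forces every column of \<open>M\<close> to have at
  most one nonzero entry. Then \<open>M\<close> times its conjugate transpose is diagonal, which says that
  \<open>A * A\<close> is circulant. Therefore the cyclic shift of the labels preserves the relation of having
  a common neighbour. It permutes the classes of the generated equivalence relation transitively,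
  so these all have the same size \<open>v\<close>. A nonbipartite component is one such class, a bipartite
  component consists of two, namely its sides.
\<close>

section \<open>Hermitian matrices and energy\<close>

definition ctranspose :: "complex mat \<Rightarrow> complex mat" where
  "ctranspose A = mat (dim_col A) (dim_row A) (\<lambda>(i, j). cnj (A $$ (j, i)))"

lemma ctranspose_carrier [simp]: "A \<in> carrier_mat m n \<Longrightarrow> ctranspose A \<in> carrier_mat n m"
  by (auto simp: ctranspose_def)

lemma ctranspose_index [simp]:
  "i < dim_col A \<Longrightarrow> j < dim_row A \<Longrightarrow> ctranspose A $$ (i, j) = cnj (A $$ (j, i))"
  by (simp add: ctranspose_def)

lemma dim_ctranspose [simp]:
  "dim_row (ctranspose A) = dim_col A" "dim_col (ctranspose A) = dim_row A"
  by (simp_all add: ctranspose_def)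

lemma ctranspose_ctranspose [simp]: "ctranspose (ctranspose A) = A"
  by (rule eq_matI) auto

lemma ctranspose_one [simp]: "ctranspose (1\<^sub>m n) = 1\<^sub>m n"
  by (rule eq_matI) auto

lemma mult_mat_index:
  assumes "A \<in> carrier_mat l m" "B \<in> carrier_mat m n" "i < l" "j < n"
  shows "(A * B) $$ (i, j) = (\<Sum>k<m. A $$ (i, k) * B $$ (k, j))"
  using assms by (auto simp: scalar_prod_def atLeast0LessThan)

lemma ctranspose_mult:
  assumes "A \<in> carrier_mat l m" "B \<in> carrier_mat m n"
  shows "ctranspose (A * B) = ctranspose B * ctranspose A"
proof (rule eq_matI)
  fix i j assume "i < dim_row (ctranspose B * ctranspose A)" "j < dim_col (ctranspose B * ctranspose A)"
  then have ij: "i < n" "j < l" using assms by auto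
  show "ctranspose (A * B) $$ (i, j) = (ctranspose B * ctranspose A) $$ (i, j)"
    using ij assms mult_mat_index[OF assms ij(2,1)]
      mult_mat_index[OF ctranspose_carrier[OF assms(2)] ctranspose_carrier[OF assms(1)] ij]
    by (simp add: cnj_sum mult.commute)
qed (use assms in auto)

lemma diagonal_mult_index:
  fixes D :: "complex mat"
  assumes D: "D \<in> carrier_mat m m" "diagonal_mat D" and A: "A \<in> carrier_mat m n"
    and ij: "i < m" "j < n"
  shows "(D * A) $$ (i, j) = D $$ (i, i) * A $$ (i, j)"
proof -
  have "(D * A) $$ (i, j) = (\<Sum>k<m. if k = i then D $$ (i, i) * A $$ (i, j) else 0)"
    unfolding mult_mat_index[OF D(1) A ij]
    using D ij by (intro sum.cong) (auto simp: diagonal_mat_def)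
  then show ?thesis using ij by simp
qed

lemma mult_diagonal_index:
  fixes D :: "complex mat"
  assumes D: "D \<in> carrier_mat n n" "diagonal_mat D" and A: "A \<in> carrier_mat m n"
    and ij: "i < m" "j < n"
  shows "(A * D) $$ (i, j) = A $$ (i, j) * D $$ (j, j)"
proof -
  have "(A * D) $$ (i, j) = (\<Sum>k<n. if k = j then A $$ (i, j) * D $$ (j, j) else 0)"
    unfolding mult_mat_index[OF A D(1) ij]
    using D ij by (intro sum.cong) (auto simp: diagonal_mat_def)
  then show ?thesis using ij by simp
qed

definition trace :: "complex mat \<Rightarrow> complex" where
  "trace A = (\<Sum>i<dim_row A. A $$ (i, i))"

lemma trace_mult:
  assumes "A \<in> carrier_mat m n" "B \<in> carrier_mat n m"
  shows "trace (A * B) = (\<Sum>i<m. \<Sum>k<n. A $$ (i, k) * B $$ (k, i))"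
proof -
  have "dim_row (A * B) = m" using assms by auto
  then show ?thesis unfolding trace_def by (simp add: mult_mat_index[OF assms])
qed

lemma trace_mult_comm:
  assumes "A \<in> carrier_mat m n" "B \<in> carrier_mat n m"
  shows "trace (A * B) = trace (B * A)"
  unfolding trace_mult[OF assms] trace_mult[OF assms(2,1)]
  by (subst sum.swap) (simp add: mult.commute)

section \<open>Hermitian matrices are diagonalizable\<close>

lemma hermitian_cscalar_prod:
  assumes A: "A \<in> carrier_mat n n" and herm: "ctranspose A = A"
    and x: "x \<in> carrier_vec n" and y: "y \<in> carrier_vec n"
  shows "(A *\<^sub>v x) \<bullet>c y = x \<bullet>c (A *\<^sub>v y)"
proof -
  have sym: "cnj (A $$ (i, j)) = A $$ (j, i)" if "i < n" "j < n" for i j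
    using arg_cong[OF herm, of "\<lambda>M. M $$ (j, i)"] A that by auto
  have "(A *\<^sub>v x) \<bullet>c y = (\<Sum>i<n. \<Sum>j<n. A $$ (i, j) * x $ j * cnj (y $ i))"
    using A x y by (auto simp: scalar_prod_def atLeast0LessThan sum_distrib_right intro!: sum.cong)
  also have "\<dots> = (\<Sum>j<n. \<Sum>i<n. A $$ (i, j) * x $ j * cnj (y $ i))"
    by (rule sum.swap)
  also have "\<dots> = x \<bullet>c (A *\<^sub>v y)"
    using A x y sym
    by (auto simp: scalar_prod_def atLeast0LessThan sum_distrib_left cnj_sum mult_ac intro!: sum.cong)
  finally show ?thesis .
qed

lemma hermitian_eigenvalue_real:
  assumes A: "A \<in> carrier_mat n n" and herm: "ctranspose A = A" and ev: "eigenvalue A \<mu>"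
  shows "cnj \<mu> = \<mu>"
proof -
  obtain v where v: "v \<in> carrier_vec n" "v \<noteq> 0\<^sub>v n" "A *\<^sub>v v = \<mu> \<cdot>\<^sub>v v"
    using ev A by (auto simp: eigenvalue_def eigenvector_def)
  have "\<mu> * (v \<bullet>c v) = cnj \<mu> * (v \<bullet>c v)"
    using hermitian_cscalar_prod[OF A herm v(1) v(1)] v
    by (simp add: conjugate_smult_vec)
  moreover have "v \<bullet>c v \<noteq> 0" using conjugate_square_eq_0_vec[OF v(1)] v(2) by simp
  ultimately show ?thesis by simp
qed

text \<open>If \<open>A * A\<close> kills \<open>x\<close>, then the squared norm of
  \<open>A *\<^sub>v x\<close> is the product of \<open>x\<close> with
  \<open>A *\<^sub>v (A *\<^sub>v x)\<close>, which is 0. Applied to \<open>A\<close> minus an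
  eigenvalue, this rules out generalized eigenvectors of order 2.\<close>

lemma hermitian_kernel_square:
  assumes A: "A \<in> carrier_mat n n" and herm: "ctranspose A = A"
  shows "mat_kernel (A * A) = mat_kernel A"
proof -
  have AA: "A * A \<in> carrier_mat n n" using A by simp
  have "A *\<^sub>v x = 0\<^sub>v n \<longleftrightarrow> (A * A) *\<^sub>v x = 0\<^sub>v n" if x: "x \<in> carrier_vec n" for x
  proof
    assume "A *\<^sub>v x = 0\<^sub>v n"
    then show "(A * A) *\<^sub>v x = 0\<^sub>v n" using A x by (auto simp: assoc_mult_mat_vec[OF A A x])
  next
    assume "(A * A) *\<^sub>v x = 0\<^sub>v n"
    then have "A *\<^sub>v (A *\<^sub>v x) = 0\<^sub>v n" using assoc_mult_mat_vec[OF A A x] by simp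
    then have "(A *\<^sub>v x) \<bullet>c (A *\<^sub>v x) = 0"
      using hermitian_cscalar_prod[OF A herm x, of "A *\<^sub>v x"] A x by simp
    moreover have "A *\<^sub>v x \<in> carrier_vec n" using A x by simp
    ultimately show "A *\<^sub>v x = 0\<^sub>v n" using conjugate_square_eq_0_vec by blast
  qed
  then show ?thesis using mat_kernel[OF A] mat_kernel[OF AA] by auto
qed

lemma jordan_nf_similar_diagonal:
  assumes "jordan_nf A n_as" "\<And>k a. (k, a) \<in> set n_as \<Longrightarrow> k = 1"
  shows "\<exists>B. similar_mat A B \<and> diagonal_mat B"
proof -
  have "jordan_matrix n_as = mk_diagonal (map snd n_as)"
    unfolding jordan_matrix_def mk_diagonal_def map_map
    using assms(2)
    by (intro arg_cong[of _ _ diag_block_mat] map_cong refl) (force simp: jordan_block_def intro!: eq_matI)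
  then show ?thesis using assms(1) mk_diagonal_diagonal unfolding jordan_nf_def by metis
qed

text \<open>The sums are compared term by term, with strict inequality wherever \<open>n\<close>
  exceeds 1. In the application \<open>ns\<close> lists the sizes of the Jordan blocks of one
  eigenvalue, and the sums are the dimensions of its generalized eigenspaces of order 1 and
  2.\<close>

lemma sum_list_min_eq:
  assumes "(\<Sum>n\<leftarrow>ns. min (Suc 0) n) = (\<Sum>n\<leftarrow>ns. min 2 n)" "n \<in> set ns"
  shows "n \<le> 1"
proof -
  have le: "(\<Sum>n\<leftarrow>ms. min (Suc 0) n) \<le> (\<Sum>n\<leftarrow>ms. min 2 n)" for ms
    by (rule sum_list_mono) simp
  show ?thesis using assms
  proof (induction ns)
    case (Cons m ms)
    then show ?case using le[of ms] by (auto simp: min_def split: if_splits)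
  qed simp
qed

text \<open>The eigenvalue \<open>a\<close> is real, so \<open>A\<close> shifted by \<open>a\<close>
  is again Hermitian and has the same kernel as its square. The generalized eigenspaces of order 1
  and 2 therefore have equal dimension, which leaves no room for a block larger than 1.\<close>

lemma hermitian_jordan_block_size:
  assumes A: "A \<in> carrier_mat n n" and herm: "ctranspose A = A"
    and jnf: "jordan_nf A n_as" and mem: "(k, a) \<in> set n_as"
  shows "k = 1"
proof -
  \<comment> \<open>Blocks of size 0 are excluded by \<open>jordan_nf\<close>; at the end this turns
    \<open>k \<le> 1\<close> into \<open>k = 1\<close>.\<close>
  have k0: "k \<noteq> 0" using jnf mem unfolding jordan_nf_def by force
  have "Polynomial.order a (char_poly A) > 0"
  proof -
    have "k \<le> Polynomial.order a (char_poly A)" by (rule jordan_nf_block_size_order_bound[OF jnf mem])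
    then show ?thesis using k0 by simp
  qed
  then have "eigenvalue A a"
    using order_root[of "char_poly A" a] eigenvalue_root_char_poly[OF A] by simp
  then have real: "cnj a = a" by (rule hermitian_eigenvalue_real[OF A herm])
  let ?H = "char_matrix A a"
  have H: "?H \<in> carrier_mat n n" using A by simp
  have "ctranspose ?H = ?H"
  proof (rule eq_matI)
    fix i j assume "i < dim_row ?H" "j < dim_col ?H"
    then have ij: "i < n" "j < n" using H by auto
    have "cnj (A $$ (j, i)) = A $$ (i, j)"
      using arg_cong[OF herm, of "\<lambda>M. M $$ (i, j)"] A ij by auto
    then show "ctranspose ?H $$ (i, j) = ?H $$ (i, j)"
      using A ij real by (auto simp: char_matrix_def ctranspose_def)
  qed (use H in auto)
  then have ker: "mat_kernel (?H * ?H) = mat_kernel ?H" by (rule hermitian_kernel_square[OF H])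
  have "?H ^\<^sub>m 1 = ?H" "?H ^\<^sub>m 2 = ?H * ?H" using H by (auto simp: numeral_2_eq_2)
  then have "dim_gen_eigenspace A a 1 = dim_gen_eigenspace A a 2"
    using H ker by (simp add: dim_gen_eigenspace_def kernel_dim_def)
  then have eq: "(\<Sum>n\<leftarrow>map fst [(n, e)\<leftarrow>n_as. e = a]. min (Suc 0) n) = (\<Sum>n\<leftarrow>map fst [(n, e)\<leftarrow>n_as. e = a]. min 2 n)"
    using dim_gen_eigenspace[OF jnf] by simp
  have "k \<in> set (map fst [(n, e)\<leftarrow>n_as. e = a])" using mem by force
  from sum_list_min_eq[OF eq this] k0 show ?thesis by simp
qed

text \<open>The witnesses come from the Jordan normal form, so \<open>P\<close> and \<open>Q\<close>
  are only known to be inverse to each other; unitarity is not provided.\<close>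

lemma hermitian_diagonalizable:
  assumes A: "A \<in> carrier_mat n n" and herm: "ctranspose A = A"
  obtains B P Q where "similar_mat_wit A B P Q" "diagonal_mat B"
proof -
  obtain es where "char_poly A = (\<Prod>a\<leftarrow>es. [:- a, 1:])" using char_poly_factorized[OF A] by blast
  from jordan_nf_exists[OF A this] obtain n_as where jnf: "jordan_nf A n_as" by blast
  have "\<exists>B. similar_mat A B \<and> diagonal_mat B"
    by (rule jordan_nf_similar_diagonal[OF jnf]) (rule hermitian_jordan_block_size[OF A herm jnf])
  then show ?thesis using that unfolding similar_mat_def by blast
qed

section \<open>Energy and the sign of a Hermitian matrix\<close>

lemma order_prod_list_linear:
  "Polynomial.order x (\<Prod>a\<leftarrow>as. [:- a, 1:]) = count_list as (x :: 'a :: field)"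
proof (induction as)
  case (Cons a as)
  have nz: "(\<Prod>a\<leftarrow>as. [:- a, 1:]) \<noteq> 0" by (auto simp: prod_list_zero_iff)
  have "Polynomial.order x (\<Prod>a\<leftarrow>a # as. [:- a, 1:]) = Polynomial.order x [:- a, 1:] + Polynomial.order x (\<Prod>a\<leftarrow>as. [:- a, 1:])"
    using nz by (simp del: mult_pCons_left add: order_mult)
  moreover have "Polynomial.order x [:- a, 1:] = (if a = x then 1 else 0)"
    by (simp add: order_linear')
  ultimately show ?case using Cons.IH by simp
qed simp

lemma sum_count_list:
  fixes f :: "'a \<Rightarrow> real"
  shows "(\<Sum>x\<in>set xs. real (count_list xs x) * f x) = (\<Sum>x\<leftarrow>xs. f x)"
proof -
  \<comment> \<open>A fixed finite superset \<open>S\<close> replaces \<open>set xs\<close>, which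
    would change during the induction.\<close>
  have "(\<Sum>x\<in>S. real (count_list xs x) * f x) = (\<Sum>x\<leftarrow>xs. f x)"
    if "finite S" "set xs \<subseteq> S" for S
    using that(2)
  proof (induction xs)
    case (Cons a xs)
    have "(\<Sum>x\<in>S. real (count_list (a # xs) x) * f x)
        = (\<Sum>x\<in>S. real (count_list xs x) * f x + (if x = a then f x else 0))"
      by (rule sum.cong) (auto simp: algebra_simps)
    also have "\<dots> = (\<Sum>x\<in>S. real (count_list xs x) * f x) + f a"
      using Cons.prems that(1) by (simp add: sum.distrib sum.delta)
    finally show ?case using Cons by simp
  qed simp
  then show ?thesis by simp
qed

text \<open>The multiplicity of a root is the number of its occurrences in \<open>as\<close>, so the
  weighted sum over the spectrum unfolds into an unweighted sum over the list.\<close>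

lemma matrix_energy_char_poly:
  assumes A: "A \<in> carrier_mat n n" and cp: "char_poly A = (\<Prod>a\<leftarrow>as. [:- a, 1:])"
  shows "matrix_energy A = (\<Sum>a\<leftarrow>as. cmod a)"
proof -
  have "spectrum A = set as"
    unfolding spectrum_root_char_poly[OF A] cp
    by (force simp: poly_prod_list prod_list_zero_iff)
  then show ?thesis
    unfolding matrix_energy_def cp order_prod_list_linear by (simp add: sum_count_list)
qed

text \<open>\<open>U\<close> is the sign function applied to \<open>A\<close>: the eigenvalues in
  the diagonalization are replaced by their signs. As \<open>P\<close> need not be unitary, the
  Hermitian property of \<open>U\<close> has to be derived from the Gram matrix \<open>H\<close> of
  the eigenvectors, which commutes with the matrix \<open>S\<close> of signs.\<close>

lemma hermitian_sign:
  assumes A: "A \<in> carrier_mat n n" and herm: "ctranspose A = A"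
  obtains U where "U \<in> carrier_mat n n" "ctranspose U = U" "U * U = 1\<^sub>m n"
    "trace (U * A) = complex_of_real (matrix_energy A)"
proof -
  obtain B P Q where wit: "similar_mat_wit A B P Q" and diag: "diagonal_mat B"
    by (rule hermitian_diagonalizable[OF A herm])
  from similar_mat_witD2[OF A wit]
  have PQ: "P * Q = 1\<^sub>m n" and QP: "Q * P = 1\<^sub>m n" and APBQ: "A = P * B * Q"
    and B [simp]: "B \<in> carrier_mat n n" and P [simp]: "P \<in> carrier_mat n n"
    and Q [simp]: "Q \<in> carrier_mat n n" by auto
  define b where "b i = B $$ (i, i)" for i
  have Bij: "B $$ (i, j) = (if i = j then b i else 0)" if "i < n" "j < n" for i j
    using diag that B by (auto simp: diagonal_mat_def b_def)
  have cp: "char_poly A = (\<Prod>a\<leftarrow>diag_mat B. [:- a, 1:])"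
    using char_poly_upper_triangular[OF B] char_poly_similar[of A B] wit Bij B
    by (auto simp: similar_mat_def upper_triangular_def)
  have diag_B: "diag_mat B = map b [0..<n]" using carrier_matD[OF B] by (auto simp: diag_mat_def b_def)
  have breal: "cnj (b i) = b i" if "i < n" for i
  proof -
    have "b i \<in> set (diag_mat B)" using that diag_B by simp
    then have "eigenvalue A (b i)"
      unfolding eigenvalue_root_char_poly[OF A] cp by (force simp: poly_prod_list prod_list_zero_iff)
    then show ?thesis by (rule hermitian_eigenvalue_real[OF A herm])
  qed
  have energy: "matrix_energy A = (\<Sum>i<n. cmod (b i))"
    using matrix_energy_char_poly[OF A cp]
    by (simp add: diag_B comp_def sum_list_sum_nth atLeast0LessThan)
  \<comment> \<open>The eigenvalue 0 gets the sign 1 and not 0, which makes \<open>S\<close> an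
    involution.\<close>
  define s :: "nat \<Rightarrow> complex" where "s i = (if Re (b i) \<ge> 0 then 1 else -1)" for i
  define S where "S = mat n n (\<lambda>(i, j). if i = j then s i else 0)"
  have S [simp]: "S \<in> carrier_mat n n" by (simp add: S_def)
  have Sij: "S $$ (i, j) = (if i = j then s i else 0)" if "i < n" "j < n" for i j
    using that by (simp add: S_def)
  have Sdiag: "diagonal_mat S" by (simp add: S_def diagonal_mat_def)
  have SS: "S * S = 1\<^sub>m n"
    using carrier_matD[OF S] by (intro eq_matI)
      (auto simp: diagonal_mult_index[OF S Sdiag S] Sij s_def simp del: index_mult_mat(1))
  have Sc: "ctranspose S = S"
    by (rule eq_matI) (auto simp: ctranspose_def S_def s_def)
  have Bc: "ctranspose B = B"
    using carrier_matD[OF B] by (intro eq_matI) (auto simp: Bij breal)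
  note [simp] = assoc_mult_mat[of _ n n _ n _ n] mult_carrier_mat[of _ n n _ n]
    right_mult_one_mat[of _ n n] left_mult_one_mat[of _ n n]
  have QPX: "Q * (P * X) = X" if "X \<in> carrier_mat n n" for X
    using that assoc_mult_mat[OF Q P that] QP by auto
  have QPc: "ctranspose P * ctranspose Q = 1\<^sub>m n" "ctranspose Q * ctranspose P = 1\<^sub>m n"
    unfolding ctranspose_mult[OF P Q, symmetric] ctranspose_mult[OF Q P, symmetric] PQ QP
    by simp_all
  note dag [simp] = ctranspose_carrier[OF P] ctranspose_carrier[OF Q]
  have QPcX: "ctranspose P * (ctranspose Q * X) = X" "ctranspose Q * (ctranspose P * X) = X"
    if "X \<in> carrier_mat n n" for X
    using that assoc_mult_mat[OF dag(1,2) that] assoc_mult_mat[OF dag(2,1) that] QPc by auto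
  define H where "H = ctranspose P * P"
  have H [simp]: "H \<in> carrier_mat n n" using dag by (simp add: H_def)
  \<comment> \<open>A second factorization of \<open>A\<close>, obtained as the adjoint of
    \<open>P * B * Q\<close>. Evaluating \<open>ctranspose P * A * P\<close> with either
    factorization gives \<open>HB\<close>.\<close>
  have A2: "A = ctranspose Q * (B * ctranspose P)"
  proof -
    have "ctranspose (P * B * Q) = ctranspose Q * (ctranspose B * ctranspose P)"
      using ctranspose_mult[of "P * B" n n Q n] ctranspose_mult[OF P B] by simp
    then show ?thesis using herm APBQ Bc by simp
  qed
  have HB: "H * B = B * H"
  proof -
    have "H * B = ctranspose P * (A * P)"
      using dag by (simp add: H_def APBQ QP)
    also have "\<dots> = B * H"
      using dag by (simp add: H_def A2 QPcX)
    finally show ?thesis .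
  qed
  have HS: "H * S = S * H"
  proof (rule eq_matI)
    fix i j assume "i < dim_row (S * H)" "j < dim_col (S * H)"
    then have ij: "i < n" "j < n" using carrier_matD[OF S] carrier_matD[OF H] by auto
    have "H $$ (i, j) * b j = b i * H $$ (i, j)"
      using arg_cong[OF HB, of "\<lambda>M. M $$ (i, j)"] ij
      by (simp add: mult_diagonal_index[OF B diag H] diagonal_mult_index[OF B diag H] b_def
          del: index_mult_mat(1))
    \<comment> \<open>\<open>H\<close> can be nonzero only between indices of equal eigenvalue, and
      these have equal signs; so \<open>H\<close> commutes with \<open>S\<close> as well.\<close>
    then have "H $$ (i, j) = 0 \<or> b i = b j" by auto
    then have "H $$ (i, j) * s j = s i * H $$ (i, j)" by (auto simp: s_def)
    then show "(H * S) $$ (i, j) = (S * H) $$ (i, j)"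
      using ij
      by (simp add: mult_diagonal_index[OF S Sdiag H] diagonal_mult_index[OF S Sdiag H] Sij
          del: index_mult_mat(1))
  qed (use carrier_matD[OF S] carrier_matD[OF H] in auto)
  define U where "U = P * (S * Q)"
  have U: "U \<in> carrier_mat n n" by (simp add: U_def)
  moreover have "ctranspose U = U"
  proof -
    have "ctranspose U = ctranspose Q * (S * ctranspose P)"
      using ctranspose_mult[of P n n "S * Q" n] ctranspose_mult[OF S Q] dag Sc by (simp add: U_def)
    \<comment> \<open>\<open>ctranspose P\<close> equals \<open>H * Q\<close>, since
      \<open>P * Q\<close> is the identity. Once \<open>H\<close> is moved past \<open>S\<close>,
      the product \<open>ctranspose Q * H\<close> collapses to \<open>P\<close>.\<close>
    also have "\<dots> = ctranspose Q * ((S * H) * Q)"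
      using dag by (simp add: H_def PQ)
    also have "\<dots> = U"
      unfolding HS[symmetric] using dag by (simp add: H_def U_def QPcX)
    finally show ?thesis .
  qed
  moreover have "U * U = 1\<^sub>m n"
  proof -
    have "S * (S * Q) = Q" using SS by (metis assoc_mult_mat left_mult_one_mat Q S)
    then show ?thesis by (simp add: U_def QPX PQ)
  qed
  moreover have "trace (U * A) = complex_of_real (matrix_energy A)"
  proof -
    have "U * A = P * (S * (B * Q))" by (simp add: U_def APBQ QPX)
    then have "trace (U * A) = trace ((S * (B * Q)) * P)"
      using trace_mult_comm[OF P, of "S * (B * Q)"] by simp
    also have "(S * (B * Q)) * P = S * B" by (simp add: QP)
    also have "trace (S * B) = (\<Sum>i<n. s i * b i)"
      using carrier_matD[OF S]
      by (simp add: trace_def diagonal_mult_index[OF S Sdiag B] Sij b_def del: index_mult_mat(1))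
    also have "\<dots> = (\<Sum>i<n. complex_of_real (cmod (b i)))"
    proof (rule sum.cong)
      fix i assume "i \<in> {..<n}"
      then have "Im (b i) = 0" using breal[of i] by (simp add: complex_eq_iff)
      then have "b i = complex_of_real (Re (b i))" by (simp add: complex_eq_iff)
      moreover from this have "cmod (b i) = \<bar>Re (b i)\<bar>" by (metis norm_of_real)
      ultimately show "s i * b i = complex_of_real (cmod (b i))"
        by (auto simp: s_def complex_eq_iff)
    qed simp
    finally show ?thesis by (simp add: energy)
  qed
  ultimately show ?thesis by (rule that)
qed

section \<open>The equality case for the Fourier matrix\<close>

text \<open>This is a full geometric sum of an \<open>N\<close>-th root of unity, which differs from
  1 because \<open>m\<close> and \<open>m'\<close> are distinct residues.\<close>

lemma cis_root_sum:
  fixes m m' N :: nat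
  assumes "m < N" "m' < N" "m \<noteq> m'"
  shows "(\<Sum>x<N. cis (- (2 * pi * real m * real x / real N)) *
           cnj (cis (- (2 * pi * real m' * real x / real N)))) = 0"
proof -
  \<comment> \<open>The summand at \<open>x\<close> is the \<open>x\<close>-th power of
    \<open>cis (2 * pi * t)\<close>.\<close>
  define t where "t = (real m' - real m) / real N"
  have N: "N > 0" using assms by simp
  have z_pow: "cis (- (2 * pi * real m * real x / real N)) *
           cnj (cis (- (2 * pi * real m' * real x / real N))) = cis (2 * pi * t) ^ x" for x
    using N unfolding t_def DeMoivre cis_cnj cis_mult
    by (intro arg_cong[of _ _ cis]) (simp add: field_simps)
  have "real N * (2 * pi * t) = 2 * pi * of_int (int m' - int m)"
    using N by (simp add: t_def field_simps)
  then have zN: "cis (2 * pi * t) ^ N = 1"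
    unfolding DeMoivre using cis_multiple_2pi[OF Ints_of_int] by metis
  have "cis (2 * pi * t) \<noteq> 1"
  proof
    assume "cis (2 * pi * t) = 1"
    then have "cos (2 * pi * t) = 1" by (simp add: complex_eq_iff)
    then obtain k :: int where "2 * pi * t = of_int k * 2 * pi"
      by (auto simp: cos_one_2pi_int)
    then have "t = of_int k" by simp
    then have "real m' - real m = real_of_int k * real N" using N by (simp add: t_def field_simps)
    then have "int m' - int m = k * int N"
      by (metis of_int_diff of_int_eq_iff of_int_mult of_int_of_nat_eq)
    then have "int N dvd int m' - int m" by simp
    moreover have "\<bar>int m' - int m\<bar> < int N" using assms by auto
    ultimately have "int m' - int m = 0" by (metis zdvd_not_zless zero_less_abs_iff dvd_abs_iff)
    then show False using assms(3) by simp
  qed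
  then show ?thesis unfolding z_pow using geometric_sum[of "cis (2 * pi * t)" N] zN by simp
qed

lemma fourier_matrix_carrier [simp]: "fourier_matrix N \<in> carrier_mat N N"
  by (simp add: fourier_matrix_def)

lemma fourier_matrix_index:
  assumes "m < N" "x < N"
  shows "fourier_matrix N $$ (m, x) =
    complex_of_real (1 / sqrt (real N)) * cis (- (2 * pi * real m * real x / real N))"
  using assms by (simp add: fourier_matrix_def cis_conv_exp mult_ac)

text \<open>Distinct rows are orthogonal by \<open>cis_root_sum\<close> and every row has norm 1.
  The second identity follows because a right inverse of a square matrix is also a left
  inverse.\<close>

lemma fourier_matrix_unitary:
  shows "fourier_matrix N * ctranspose (fourier_matrix N) = 1\<^sub>m N"
    and "ctranspose (fourier_matrix N) * fourier_matrix N = 1\<^sub>m N"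
proof -
  let ?F = "fourier_matrix N"
  have F: "?F \<in> carrier_mat N N" by simp
  note Fc = ctranspose_carrier[OF F]
  show "?F * ctranspose ?F = 1\<^sub>m N"
  proof (rule eq_matI)
    fix m m' assume "m < dim_row (1\<^sub>m N :: complex mat)" "m' < dim_col (1\<^sub>m N :: complex mat)"
    then have mm: "m < N" "m' < N" by auto
    define e where "e m x = cis (- (2 * pi * real m * real x / real N))" for m x :: nat
    have sq: "complex_of_real (sqrt (real N)) * complex_of_real (sqrt (real N)) = of_nat N"
      by (simp flip: of_real_mult)
    have "(?F * ctranspose ?F) $$ (m, m') = (\<Sum>x<N. ?F $$ (m, x) * cnj (?F $$ (m', x)))"
      unfolding mult_mat_index[OF F Fc mm] using mm carrier_matD[OF F] by (intro sum.cong) auto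
    also have "\<dots> = (\<Sum>x<N. (1 / of_nat N) * (e m x * cnj (e m' x)))"
      using mm sq by (intro sum.cong) (auto simp: fourier_matrix_index e_def field_simps)
    also have "\<dots> = (1 / of_nat N) * (\<Sum>x<N. e m x * cnj (e m' x))" by (simp add: sum_distrib_left)
    also have "\<dots> = (if m = m' then 1 else 0)"
    proof (cases "m = m'")
      case True
      have "e m x * cnj (e m x) = 1" for x
        by (simp add: e_def cis_cnj cis_mult)
      then show ?thesis using True mm by simp
    next
      case False
      then show ?thesis using cis_root_sum[OF mm False] by (simp add: e_def)
    qed
    finally show "(?F * ctranspose ?F) $$ (m, m') = 1\<^sub>m N $$ (m, m')" using mm by simp
  qed (use carrier_matD[OF F] in auto)
  then show "ctranspose ?F * ?F = 1\<^sub>m N" by (rule mat_mult_left_right_inverse[OF F Fc])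
qed

text \<open>Moving the column index by one costs a phase that depends on the row only. This is what
  makes diagonal matrices in the Fourier basis invariant under the shift.\<close>

lemma fourier_matrix_shift:
  assumes "m < N" "x < N"
  shows "fourier_matrix N $$ (m, Suc x mod N) =
    cis (- (2 * pi * real m / real N)) * fourier_matrix N $$ (m, x)"
proof -
  have N: "N > 0" using assms by simp
  have "cis (- (2 * pi * real m * real (Suc x mod N) / real N)) =
    cis (- (2 * pi * real m * real (Suc x) / real N))"
  proof (cases "Suc x < N")
    \<comment> \<open>The index wraps around to 0 here; the exponent then changes by a whole number
      of turns.\<close>
    case False
    then have "Suc x = N" using assms(2) by simp
    moreover have "cis (- (2 * pi * real m)) = 1"
      using cis_multiple_2pi[of "- real m"] by simp
    ultimately show ?thesis using N by simp
  qed simp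
  also have "\<dots> = cis (- (2 * pi * real m / real N)) * cis (- (2 * pi * real m * real x / real N))"
    unfolding cis_mult using N by (intro arg_cong[of _ _ cis]) (simp add: field_simps)
  finally show ?thesis using assms by (simp add: fourier_matrix_index)
qed

section \<open>Norms under unitary factors and the case of equality\<close>

lemma l1_norm_mat_carrier:
  "M \<in> carrier_mat m n \<Longrightarrow> l1_norm_mat M = (\<Sum>i<m. \<Sum>j<n. cmod (M $$ (i, j)))"
  by (auto simp: l1_norm_mat_def)

lemma frobenius_norm_square:
  assumes M: "M \<in> carrier_mat m n"
  shows "complex_of_real ((frobenius_norm M)\<^sup>2) = trace (M * ctranspose M)"
proof -
  have "(frobenius_norm M)\<^sup>2 = (\<Sum>i<m. \<Sum>j<n. (cmod (M $$ (i, j)))\<^sup>2)"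
    using M by (simp add: frobenius_norm_def sum_nonneg)
  also have "complex_of_real \<dots> = (\<Sum>i<m. \<Sum>j<n. M $$ (i, j) * ctranspose M $$ (j, i))"
    unfolding of_real_sum
    using M by (intro sum.cong refl) (auto simp: complex_norm_square[symmetric])
  also have "\<dots> = trace (M * ctranspose M)"
    using trace_mult[OF M ctranspose_carrier[OF M]] by simp
  finally show ?thesis .
qed

text \<open>The squared norm is the trace of \<open>M * ctranspose M\<close>. For
  \<open>M = F * A * F\<close> the inner factors cancel, and the outer ones cancel by cyclicity of
  the trace. The lemma evaluates the denominator of the Fourier ratio.\<close>

lemma frobenius_norm_unitary:
  assumes A [simp]: "A \<in> carrier_mat n n" and F [simp]: "F \<in> carrier_mat n n"
    and FF: "F * ctranspose F = 1\<^sub>m n" "ctranspose F * F = 1\<^sub>m n"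
  shows "frobenius_norm (F * A * F) = frobenius_norm A"
proof -
  let ?F' = "ctranspose F" and ?A' = "ctranspose A"
  have [simp]: "?F' \<in> carrier_mat n n" "?A' \<in> carrier_mat n n" by simp_all
  note [simp] = assoc_mult_mat[of _ n n _ n _ n] mult_carrier_mat[of _ n n _ n]
    right_mult_one_mat[of _ n n] left_mult_one_mat[of _ n n]
  have FX: "F * (?F' * X) = X" if "X \<in> carrier_mat n n" for X
    using assoc_mult_mat[OF F _ that, of ?F'] FF that by simp
  have "ctranspose (F * A * F) = ?F' * (?A' * ?F')"
    using ctranspose_mult[of F n n "A * F" n] ctranspose_mult[of A n n F n] by simp
  then have "(F * A * F) * ctranspose (F * A * F) = F * (A * (?A' * ?F'))"
    by (simp add: FX)
  then have "trace ((F * A * F) * ctranspose (F * A * F)) = trace (A * ?A')"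
    using trace_mult_comm[of F n n "A * (?A' * ?F')"] FF by simp
  then have "complex_of_real ((frobenius_norm (F * A * F))\<^sup>2) = complex_of_real ((frobenius_norm A)\<^sup>2)"
    using frobenius_norm_square[of "F * A * F" n n] frobenius_norm_square[OF A] by simp
  then have "(frobenius_norm (F * A * F))\<^sup>2 = (frobenius_norm A)\<^sup>2" using of_real_eq_iff by blast
  moreover have "frobenius_norm X \<ge> 0" for X by (simp add: frobenius_norm_def sum_nonneg)
  ultimately show ?thesis by simp
qed

lemma unitary_row_norm:
  assumes W: "W \<in> carrier_mat n n" and WW: "W * ctranspose W = 1\<^sub>m n" and j: "j < n"
  shows "(\<Sum>i<n. (cmod (W $$ (j, i)))\<^sup>2) = 1"
proof -
  have "complex_of_real (\<Sum>i<n. (cmod (W $$ (j, i)))\<^sup>2) = (W * ctranspose W) $$ (j, j)"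
    unfolding mult_mat_index[OF W ctranspose_carrier[OF W] j j] of_real_sum
    using W j by (intro sum.cong) (auto simp: complex_norm_square[symmetric])
  then have "complex_of_real (\<Sum>i<n. (cmod (W $$ (j, i)))\<^sup>2) = complex_of_real 1"
    using WW j by simp
  then show ?thesis by (rule of_real_eq_iff[THEN iffD1])
qed

text \<open>Equality forces \<open>cmod (W $$ (j, i)) = 1\<close> wherever \<open>M $$ (i, j) \<noteq> 0\<close>, and a unit row vector
  has at most one entry of modulus 1.\<close>
lemma l1_norm_eq_trace_unitary:
  assumes M: "M \<in> carrier_mat n n" and W: "W \<in> carrier_mat n n"
    and WW: "W * ctranspose W = 1\<^sub>m n"
    and eq: "complex_of_real (l1_norm_mat M) = trace (W * M)"
    and ij: "i < n" "i' < n" "j < n" and nz: "M $$ (i, j) \<noteq> 0" "M $$ (i', j) \<noteq> 0"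
  shows "i = i'"
proof -
  have row: "(\<Sum>i<n. (cmod (W $$ (j, i)))\<^sup>2) = 1" if "j < n" for j
    by (rule unitary_row_norm[OF W WW that])
  have W1: "cmod (W $$ (j, i)) \<le> 1" if "j < n" "i < n" for i j
  proof -
    have "(cmod (W $$ (j, i)))\<^sup>2 \<le> (\<Sum>i<n. (cmod (W $$ (j, i)))\<^sup>2)"
      using that by (intro member_le_sum) auto
    then show ?thesis using row[OF that(1)] by (simp add: power_le_one_iff)
  qed
  \<comment> \<open>\<open>d i j\<close> is the slack in the termwise bound of the trace by the
    1-norm. The slacks are nonnegative and, by \<open>eq\<close>, sum to 0, so each of them
    vanishes.\<close>
  define d where "d i j = cmod (M $$ (i, j)) - Re (W $$ (j, i) * M $$ (i, j))" for i j
  have Re_le: "Re (W $$ (j, i) * M $$ (i, j)) \<le> cmod (W $$ (j, i)) * cmod (M $$ (i, j))" for i j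
    using complex_Re_le_cmod[of "W $$ (j, i) * M $$ (i, j)"] by (simp add: norm_mult)
  have d0: "d i j \<ge> 0" if "i < n" "j < n" for i j
    using Re_le[of j i] mult_right_mono[OF W1[OF that(2,1)], of "cmod (M $$ (i, j))"] by (simp add: d_def)
  have "Re (trace (W * M)) = (\<Sum>i<n. \<Sum>j<n. Re (W $$ (j, i) * M $$ (i, j)))"
    unfolding trace_mult[OF W M] by (subst sum.swap) (simp add: Re_sum)
  then have "(\<Sum>i<n. \<Sum>j<n. d i j) = 0"
    using arg_cong[OF eq, of Re] by (simp add: d_def sum_subtractf l1_norm_mat_carrier[OF M])
  then have dz: "d i j = 0" if "i < n" "j < n" for i j
  proof -
    have "(\<Sum>j<n. d i j) = 0"
      using \<open>(\<Sum>i<n. \<Sum>j<n. d i j) = 0\<close> d0 that(1)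
      by (subst (asm) sum_nonneg_eq_0_iff) (auto intro!: sum_nonneg)
    then show ?thesis using d0 that by (subst (asm) sum_nonneg_eq_0_iff) auto
  qed
  have one: "cmod (W $$ (j, i)) = 1" if i: "i < n" and nz: "M $$ (i, j) \<noteq> 0" for i
  proof -
    have "cmod (M $$ (i, j)) \<le> cmod (W $$ (j, i)) * cmod (M $$ (i, j))"
      using dz[OF i ij(3)] Re_le[of j i] by (simp add: d_def)
    then have "1 \<le> cmod (W $$ (j, i))" using nz by simp
    then show ?thesis using W1[OF ij(3) i] by simp
  qed
  show ?thesis
  proof (rule ccontr)
    assume ne: "i \<noteq> i'"
    have "(\<Sum>k\<in>{i, i'}. (cmod (W $$ (j, k)))\<^sup>2) \<le> (\<Sum>k<n. (cmod (W $$ (j, k)))\<^sup>2)"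
      using ij by (intro sum_mono2) auto
    then show False using ne row[OF ij(3)] one[OF ij(1) nz(1)] one[OF ij(2) nz(2)] by simp
  qed
qed

lemma fourier_equality_diagonal:
  assumes A [simp]: "A \<in> carrier_mat n n" and herm: "ctranspose A = A"
    and F [simp]: "F \<in> carrier_mat n n"
    and FF: "F * ctranspose F = 1\<^sub>m n" "ctranspose F * F = 1\<^sub>m n"
    and eq: "l1_norm_mat (F * A * F) = matrix_energy A"
  shows "diagonal_mat (F * (A * A) * ctranspose F)"
proof -
  let ?F' = "ctranspose F"
  have [simp]: "?F' \<in> carrier_mat n n" by simp
  note [simp] = assoc_mult_mat[of _ n n _ n _ n] mult_carrier_mat[of _ n n _ n]
    right_mult_one_mat[of _ n n] left_mult_one_mat[of _ n n]
  have FX: "F * (?F' * X) = X" "?F' * (F * X) = X" if "X \<in> carrier_mat n n" for X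
    using assoc_mult_mat[OF F _ that, of ?F'] assoc_mult_mat[of ?F' n n F n X n] FF that by simp_all
  obtain U where U [simp]: "U \<in> carrier_mat n n" and Uc: "ctranspose U = U" and UU: "U * U = 1\<^sub>m n"
    and tr: "trace (U * A) = complex_of_real (matrix_energy A)"
    by (rule hermitian_sign[OF A herm])
  \<comment> \<open>With this choice \<open>W * M\<close> is \<open>U * A\<close> conjugated by
    \<open>F\<close>, so both have the same trace, namely the energy.\<close>
  define W where "W = ?F' * U * ?F'"
  define M where "M = F * A * F"
  have W [simp]: "W \<in> carrier_mat n n" and M [simp]: "M \<in> carrier_mat n n"
    by (simp_all add: W_def M_def)
  have UX: "U * (U * X) = X" if "X \<in> carrier_mat n n" for X
    using assoc_mult_mat[OF U U that] UU that by simp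
  have "ctranspose W = F * (U * F)"
    using ctranspose_mult[of ?F' n n "U * ?F'" n] ctranspose_mult[of U n n ?F' n] by (simp add: W_def Uc)
  then have WW: "W * ctranspose W = 1\<^sub>m n" by (simp add: W_def FX UX FF)
  have "W * M = ?F' * (U * (A * F))" by (simp add: W_def M_def FX)
  then have "trace (W * M) = trace (U * A)"
    using trace_mult_comm[of ?F' n n "U * (A * F)"] by (simp add: FF)
  then have "complex_of_real (l1_norm_mat M) = trace (W * M)" using tr eq by (simp add: M_def)
  then have col: "i = i'" if "i < n" "i' < n" "j < n" "M $$ (i, j) \<noteq> 0" "M $$ (i', j) \<noteq> 0" for i i' j
    using l1_norm_eq_trace_unitary[OF M W WW] that by blast
  have Mc: "ctranspose M = ?F' * (A * ?F')"
    using ctranspose_mult[of F n n "A * F" n] ctranspose_mult[of A n n F n] by (simp add: M_def herm)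
  have MM: "F * (A * A) * ?F' = M * ctranspose M"
    unfolding Mc by (simp add: M_def FX)
  show ?thesis unfolding diagonal_mat_def MM
  proof (intro allI impI)
    fix i i' assume "i < dim_row (M * ctranspose M)" "i' < dim_col (M * ctranspose M)" and ne: "i \<noteq> i'"
    then have i: "i < n" "i' < n" using carrier_matD[OF M] by auto
    \<comment> \<open>Rows \<open>i\<close> and \<open>i'\<close> of \<open>M\<close> have disjoint
      supports, because no column has two nonzero entries.\<close>
    have "M $$ (i, j) * ctranspose M $$ (j, i') = 0" if "j < n" for j
      using col[OF i that] ne i that carrier_matD[OF M] by auto
    then show "(M * ctranspose M) $$ (i, i') = 0"
      unfolding mult_mat_index[OF M ctranspose_carrier[OF M] i] by (intro sum.neutral) blast
  qed
qed

text \<open>Writing \<open>B\<close> as \<open>?F' * D * ?F\<close> with \<open>D\<close> diagonal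
  expresses an entry as a sum over \<open>m\<close> of products of two Fourier entries, one of them
  conjugated. Shifting both indices multiplies each summand by a phase and by its conjugate, which
  cancel.\<close>

lemma fourier_diagonal_circulant:
  assumes B [simp]: "B \<in> carrier_mat N N"
    and diag: "diagonal_mat (fourier_matrix N * B * ctranspose (fourier_matrix N))"
    and xy: "x < N" "y < N"
  shows "B $$ (Suc x mod N, Suc y mod N) = B $$ (x, y)"
proof -
  let ?F = "fourier_matrix N"
  let ?F' = "ctranspose ?F"
  have F'[simp]: "?F' \<in> carrier_mat N N" by simp
  have F: "?F \<in> carrier_mat N N" by simp
  note [simp] = assoc_mult_mat[of _ N N _ N _ N] mult_carrier_mat[of _ N N _ N]
    right_mult_one_mat[of _ N N] left_mult_one_mat[of _ N N]
  define D where "D = ?F * B * ?F'"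
  have D: "D \<in> carrier_mat N N" by (simp add: D_def)
  have Ddiag: "diagonal_mat D" using diag by (simp add: D_def)
  have "B = ?F' * (?F * B)"
    using assoc_mult_mat[of ?F' N N ?F N B N] fourier_matrix_unitary(2) by simp
  also have "\<dots> = ?F' * (D * ?F)"
    by (simp add: D_def fourier_matrix_unitary(2))
  finally have BD: "B = ?F' * (D * ?F)" .
  have DF: "D * ?F \<in> carrier_mat N N" using D by simp
  have entry: "B $$ (x, y) = (\<Sum>m<N. cnj (?F $$ (m, x)) * (D $$ (m, m) * ?F $$ (m, y)))"
    if "x < N" "y < N" for x y
    apply (subst BD)
    apply (subst mult_mat_index[OF F' DF that])
    using that carrier_matD[OF F]
    by (intro sum.cong) (auto simp: diagonal_mult_index[OF D Ddiag F] simp del: index_mult_mat(1))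
  have N: "N > 0" using xy by simp
  have shift: "cnj (?F $$ (m, Suc x mod N)) * (D $$ (m, m) * ?F $$ (m, Suc y mod N)) =
    cnj (?F $$ (m, x)) * (D $$ (m, m) * ?F $$ (m, y))" if "m < N" for m
  proof -
    let ?c = "cis (- (2 * pi * real m / real N))"
    have "cnj ?c * ?c = 1" by (simp add: cis_cnj cis_mult)
    moreover have "cnj (?F $$ (m, Suc x mod N)) * (D $$ (m, m) * ?F $$ (m, Suc y mod N)) =
      (cnj ?c * ?c) * (cnj (?F $$ (m, x)) * (D $$ (m, m) * ?F $$ (m, y)))"
      by (simp add: fourier_matrix_shift[OF that xy(1)] fourier_matrix_shift[OF that xy(2)] mult_ac)
    ultimately show ?thesis by simp
  qed
  then have "(\<Sum>m<N. cnj (?F $$ (m, Suc x mod N)) * (D $$ (m, m) * ?F $$ (m, Suc y mod N))) =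
    (\<Sum>m<N. cnj (?F $$ (m, x)) * (D $$ (m, m) * ?F $$ (m, y)))"
    by (intro sum.cong refl) blast
  moreover have "Suc x mod N < N" "Suc y mod N < N" using N by simp_all
  ultimately show ?thesis using entry entry[OF xy] by simp
qed

section \<open>Adjacency matrices\<close>

text \<open>An injective self-map of a finite index set is a permutation; conjugation with its
  permutation matrix \<open>P\<close>, whose inverse is the transpose, performs the
  reindexing.\<close>

lemma similar_mat_reindex:
  fixes A :: "complex mat"
  assumes A: "A \<in> carrier_mat n n" and \<tau>: "\<And>i. i < n \<Longrightarrow> \<tau> i < n" "inj_on \<tau> {..<n}"
  shows "similar_mat (mat n n (\<lambda>(i, j). A $$ (\<tau> i, \<tau> j))) A"
proof -
  define P :: "complex mat" where "P = mat n n (\<lambda>(i, j). if j = \<tau> i then 1 else 0)"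
  have P: "P \<in> carrier_mat n n" by (simp add: P_def)
  have PX: "(P * X) $$ (i, j) = X $$ (\<tau> i, j)" if X: "X \<in> carrier_mat n n" and ij: "i < n" "j < n" for X i j
  proof -
    have "(P * X) $$ (i, j) = (\<Sum>k<n. if k = \<tau> i then X $$ (\<tau> i, j) else 0)"
      unfolding mult_mat_index[OF P X ij] using ij by (intro sum.cong) (auto simp: P_def)
    then show ?thesis using \<tau>(1)[OF ij(1)] by simp
  qed
  define Q where "Q = transpose_mat P"
  have Q: "Q \<in> carrier_mat n n" using P by (simp add: Q_def)
  have Qij: "Q $$ (i, j) = (if i = \<tau> j then 1 else 0)" if "i < n" "j < n" for i j
    using that by (simp add: Q_def P_def)
  have PQ: "P * Q = 1\<^sub>m n"
  proof (rule eq_matI)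
    fix i j assume "i < dim_row (1\<^sub>m n :: complex mat)" "j < dim_col (1\<^sub>m n :: complex mat)"
    then have ij: "i < n" "j < n" by auto
    have "\<tau> i = \<tau> j \<longleftrightarrow> i = j" using \<tau>(2) ij by (auto simp: inj_on_def)
    then show "(P * Q) $$ (i, j) = 1\<^sub>m n $$ (i, j)"
      unfolding PX[OF Q ij] using Qij[OF \<tau>(1)[OF ij(1)] ij(2)] ij by simp
  qed (use P Q in auto)
  have QP: "Q * P = 1\<^sub>m n" by (rule mat_mult_left_right_inverse[OF P Q PQ])
  have AQ: "A * Q \<in> carrier_mat n n" using A Q by simp
  have "mat n n (\<lambda>(i, j). A $$ (\<tau> i, \<tau> j)) = P * (A * Q)"
  proof (rule eq_matI)
    fix i j assume "i < dim_row (P * (A * Q))" "j < dim_col (P * (A * Q))"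
    then have ij: "i < n" "j < n" using P Q by auto
    have "(A * Q) $$ (\<tau> i, j) = (\<Sum>k<n. if k = \<tau> j then A $$ (\<tau> i, \<tau> j) else 0)"
      unfolding mult_mat_index[OF A Q \<tau>(1)[OF ij(1)] ij(2)]
      using ij by (intro sum.cong) (auto simp: Qij)
    then show "mat n n (\<lambda>(i, j). A $$ (\<tau> i, \<tau> j)) $$ (i, j) = (P * (A * Q)) $$ (i, j)"
      unfolding PX[OF AQ ij] using \<tau>(1)[OF ij(2)] ij by simp
  qed (use P Q in auto)
  also have "\<dots> = P * A * Q" using assoc_mult_mat[OF P A Q] by simp
  finally have "similar_mat_wit (mat n n (\<lambda>(i, j). A $$ (\<tau> i, \<tau> j))) A P Q"
    using mult_carrier_mat[OF mult_carrier_mat[OF P A] Q]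
    by (intro similar_mat_witI[OF PQ QP _ _ A P Q]) auto
  then show ?thesis unfolding similar_mat_def by blast
qed

lemma matrix_energy_similar:
  assumes "similar_mat A B" "A \<in> carrier_mat n n" "B \<in> carrier_mat n n"
  shows "matrix_energy A = matrix_energy B"
  unfolding matrix_energy_def spectrum_root_char_poly[OF assms(2)] spectrum_root_char_poly[OF assms(3)]
    char_poly_similar[OF assms(1)] by (rule refl)

lemma adj_matrix_carrier [simp]: "adj_matrix G \<sigma> \<in> carrier_mat (card (verts G)) (card (verts G))"
  by (simp add: adj_matrix_def)

context wf_digraph begin

lemma adj_matrix_index:
  assumes \<sigma>: "\<sigma> \<in> labelings G" and uw: "u \<in> verts G" "w \<in> verts G"
  shows "adj_matrix G \<sigma> $$ (\<sigma> u, \<sigma> w) = (if u \<rightarrow>\<^bsub>G\<^esub> w then 1 else 0)"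
proof -
  have bij: "bij_betw \<sigma> (verts G) {..<card (verts G)}" using \<sigma> by (simp add: labelings_def)
  then have lt: "\<sigma> u < card (verts G)" "\<sigma> w < card (verts G)" using uw by (auto simp: bij_betw_def)
  have "(\<exists>u' w'. \<sigma> u' = \<sigma> u \<and> \<sigma> w' = \<sigma> w \<and> u' \<rightarrow>\<^bsub>G\<^esub> w') \<longleftrightarrow> u \<rightarrow>\<^bsub>G\<^esub> w"
    using bij uw adj_in_verts by (metis bij_betw_imp_inj_on inj_on_eq_iff)
  then show ?thesis using lt by (simp add: adj_matrix_def)
qed

text \<open>Replaces the arbitrarily chosen labeling in \<open>graph_energy\<close> by any given
  one, in particular by an optimal one.\<close>

lemma graph_energy_labeling:
  assumes \<sigma>: "\<sigma> \<in> labelings G"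
  shows "graph_energy G = matrix_energy (adj_matrix G \<sigma>)"
proof -
  define \<sigma>' where "\<sigma>' = (SOME \<sigma>. \<sigma> \<in> labelings G)"
  have \<sigma>': "\<sigma>' \<in> labelings G" unfolding \<sigma>'_def using \<sigma> by (rule someI[where P = "\<lambda>\<sigma>. \<sigma> \<in> labelings G"])
  let ?n = "card (verts G)"
  have bij: "bij_betw \<sigma> (verts G) {..<?n}" "bij_betw \<sigma>' (verts G) {..<?n}"
    using \<sigma> \<sigma>' by (simp_all add: labelings_def)
  define \<rho> where "\<rho> = inv_into (verts G) \<sigma>'"
  have \<rho>: "bij_betw \<rho> {..<?n} (verts G)" unfolding \<rho>_def by (rule bij_betw_inv_into[OF bij(2)])
  have \<sigma>'\<rho>: "\<sigma>' (\<rho> i) = i" if "i < ?n" for i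
    using bij(2) that by (simp add: \<rho>_def bij_betw_inv_into_right)
  have \<rho>V: "\<rho> i \<in> verts G" if "i < ?n" for i using \<rho> that by (auto simp: bij_betw_def)
  \<comment> \<open>\<open>\<sigma> \<circ> \<rho>\<close> takes the label of a vertex under
    \<open>\<sigma>'\<close> to its label under \<open>\<sigma>\<close>.\<close>
  have \<tau>: "bij_betw (\<sigma> \<circ> \<rho>) {..<?n} {..<?n}" by (rule bij_betw_trans[OF \<rho> bij(1)])
  have "adj_matrix G \<sigma>' = mat ?n ?n (\<lambda>(i, j). adj_matrix G \<sigma> $$ ((\<sigma> \<circ> \<rho>) i, (\<sigma> \<circ> \<rho>) j))"
  proof (rule eq_matI)
    fix i j assume "i < dim_row (mat ?n ?n (\<lambda>(i, j). adj_matrix G \<sigma> $$ ((\<sigma> \<circ> \<rho>) i, (\<sigma> \<circ> \<rho>) j)))"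
      "j < dim_col (mat ?n ?n (\<lambda>(i, j). adj_matrix G \<sigma> $$ ((\<sigma> \<circ> \<rho>) i, (\<sigma> \<circ> \<rho>) j)))"
    then have ij: "i < ?n" "j < ?n" by auto
    show "adj_matrix G \<sigma>' $$ (i, j) =
        mat ?n ?n (\<lambda>(i, j). adj_matrix G \<sigma> $$ ((\<sigma> \<circ> \<rho>) i, (\<sigma> \<circ> \<rho>) j)) $$ (i, j)"
      using adj_matrix_index[OF \<sigma>' \<rho>V[OF ij(1)] \<rho>V[OF ij(2)]]
        adj_matrix_index[OF \<sigma> \<rho>V[OF ij(1)] \<rho>V[OF ij(2)]] ij
      by (simp add: \<sigma>'\<rho>)
  qed (simp_all add: adj_matrix_def)
  moreover have "similar_mat (mat ?n ?n (\<lambda>(i, j). adj_matrix G \<sigma> $$ ((\<sigma> \<circ> \<rho>) i, (\<sigma> \<circ> \<rho>) j)))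
      (adj_matrix G \<sigma>)"
    using \<tau> by (intro similar_mat_reindex) (auto simp: bij_betw_def simp del: o_apply)
  ultimately have "similar_mat (adj_matrix G \<sigma>') (adj_matrix G \<sigma>)" by simp
  then show ?thesis
    unfolding graph_energy_def \<sigma>'_def[symmetric]
    by (rule matrix_energy_similar[OF _ adj_matrix_carrier adj_matrix_carrier])
qed

end

section \<open>Edge counts and the squared adjacency matrix\<close>

text \<open>Each unordered pair in the image comes from exactly two ordered pairs, which are
  distinct by irreflexivity.\<close>

lemma card_sym_irrefl_rel:
  assumes fin: "finite E" and sym: "\<And>a b. (a, b) \<in> E \<Longrightarrow> (b, a) \<in> E" and irrefl: "\<And>a. (a, a) \<notin> E"
  shows "card E = 2 * card ((\<lambda>(a, b). {a, b}) ` E)"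
proof -
  let ?f = "\<lambda>(a, b). {a, b}"
  have fibre: "card {p \<in> E. ?f p = S} = 2" if S: "S \<in> ?f ` E" for S
  proof -
    obtain a b where ab: "S = {a, b}" "(a, b) \<in> E" using S by auto
    have ne: "a \<noteq> b" using ab(2) irrefl by blast
    have "{p \<in> E. ?f p = S} = {(a, b), (b, a)}"
      using ab sym by (auto simp: doubleton_eq_iff)
    then show ?thesis using ne by simp
  qed
  have "card E = (\<Sum>S\<in>?f ` E. card {p \<in> E. ?f p = S})"
    using sum.image_gen[OF fin, of "\<lambda>_. 1::nat" ?f] by simp
  also have "\<dots> = (\<Sum>S\<in>?f ` E. 2)" using fibre by (intro sum.cong) auto
  finally show ?thesis by simp
qed

context graph begin

lemma card_arcs_ends: "card (arcs_ends G) = 2 * graph_size G"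
proof -
  have "(\<lambda>(a, b). {a, b}) ` arcs_ends G = (\<lambda>e. {tail G e, head G e}) ` arcs G"
    by (simp add: arcs_ends_conv image_image)
  moreover have "card (arcs_ends G) = 2 * card ((\<lambda>(a, b). {a, b}) ` arcs_ends G)"
  proof (rule card_sym_irrefl_rel)
    show "finite (arcs_ends G)" by (simp add: arcs_ends_conv)
    show "(b, a) \<in> arcs_ends G" if "(a, b) \<in> arcs_ends G" for a b
      using that by (rule graph_symmetric)
    show "(a, a) \<notin> arcs_ends G" for a using no_loops by (auto simp: arcs_ends_conv)
  qed
  ultimately show ?thesis by (simp add: graph_size_def)
qed

lemma adj_matrix_hermitian: "ctranspose (adj_matrix G \<sigma>) = adj_matrix G \<sigma>"
proof (rule eq_matI)
  fix i j assume "i < dim_row (adj_matrix G \<sigma>)" "j < dim_col (adj_matrix G \<sigma>)"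
  then have ij: "i < card (verts G)" "j < card (verts G)" by (simp_all add: adj_matrix_def)
  then show "ctranspose (adj_matrix G \<sigma>) $$ (i, j) = adj_matrix G \<sigma> $$ (i, j)"
    using graph_symmetric by (auto simp: ctranspose_def adj_matrix_def)
qed (simp_all add: adj_matrix_def)

text \<open>For a matrix with entries 0 and 1 the squared norm counts the ones, and each edge
  contributes two of them.\<close>

lemma frobenius_norm_adj_matrix:
  assumes \<sigma>: "\<sigma> \<in> labelings G"
  shows "frobenius_norm (adj_matrix G \<sigma>) = sqrt (2 * real (graph_size G))"
proof -
  let ?A = "adj_matrix G \<sigma>" and ?V = "verts G" and ?E = "arcs_ends G"
  have bij: "bij_betw \<sigma> ?V {..<card ?V}" using \<sigma> by (simp add: labelings_def)
  have dims: "dim_row ?A = card ?V" "dim_col ?A = card ?V" by (simp_all add: adj_matrix_def)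
  have sub: "?E \<subseteq> ?V \<times> ?V" by (auto dest: adj_in_verts)
  have "(\<Sum>i<card ?V. \<Sum>j<card ?V. (cmod (?A $$ (i, j)))\<^sup>2)
      = (\<Sum>u\<in>?V. \<Sum>w\<in>?V. (cmod (?A $$ (\<sigma> u, \<sigma> w)))\<^sup>2)"
    by (simp add: sum.reindex_bij_betw[OF bij, symmetric])
  also have "\<dots> = (\<Sum>u\<in>?V. \<Sum>w\<in>?V. if (u, w) \<in> ?E then 1 else 0)"
    using adj_matrix_index[OF \<sigma>] by (intro sum.cong refl) simp
  also have "\<dots> = (\<Sum>p\<in>?V \<times> ?V. if p \<in> ?E then 1 else 0)"
    by (simp add: sum.cartesian_product case_prod_unfold)
  also have "\<dots> = real (card ?E)"
    using sub by (simp add: sum.If_cases Int_absorb1)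
  finally show ?thesis by (simp add: frobenius_norm_def dims card_arcs_ends)
qed

text \<open>The entry is the number of walks of length 2 from \<open>u\<close> to \<open>w\<close>,
  which by symmetry is the number of common neighbours.\<close>

lemma adj_matrix_square_nonzero:
  assumes \<sigma>: "\<sigma> \<in> labelings G" and uw: "u \<in> verts G" "w \<in> verts G"
  shows "(adj_matrix G \<sigma> * adj_matrix G \<sigma>) $$ (\<sigma> u, \<sigma> w) \<noteq> 0 \<longleftrightarrow> (\<exists>z. u \<rightarrow>\<^bsub>G\<^esub> z \<and> w \<rightarrow>\<^bsub>G\<^esub> z)"
proof -
  let ?A = "adj_matrix G \<sigma>" and ?V = "verts G"
  have bij: "bij_betw \<sigma> ?V {..<card ?V}" using \<sigma> by (simp add: labelings_def)
  then have lt: "\<sigma> u < card ?V" "\<sigma> w < card ?V" using uw by (auto simp: bij_betw_def)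
  have "(?A * ?A) $$ (\<sigma> u, \<sigma> w) = (\<Sum>z\<in>?V. ?A $$ (\<sigma> u, \<sigma> z) * ?A $$ (\<sigma> z, \<sigma> w))"
    by (simp only: mult_mat_index[OF adj_matrix_carrier adj_matrix_carrier lt]
      sum.reindex_bij_betw[OF bij, symmetric])
  also have "\<dots> = (\<Sum>z\<in>?V. if u \<rightarrow>\<^bsub>G\<^esub> z \<and> z \<rightarrow>\<^bsub>G\<^esub> w then 1 else 0)"
    using uw by (intro sum.cong refl) (simp add: adj_matrix_index[OF \<sigma>])
  also have "\<dots> = of_nat (card {z \<in> ?V. u \<rightarrow>\<^bsub>G\<^esub> z \<and> z \<rightarrow>\<^bsub>G\<^esub> w})"
    by (simp add: sum.If_cases Int_def)
  finally have "(?A * ?A) $$ (\<sigma> u, \<sigma> w) \<noteq> 0 \<longleftrightarrow> (\<exists>z\<in>?V. u \<rightarrow>\<^bsub>G\<^esub> z \<and> z \<rightarrow>\<^bsub>G\<^esub> w)"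
    by auto
  also have "\<dots> \<longleftrightarrow> (\<exists>z. u \<rightarrow>\<^bsub>G\<^esub> z \<and> w \<rightarrow>\<^bsub>G\<^esub> z)"
    using graph_symmetric adj_in_verts by blast
  finally show ?thesis .
qed

lemma adj_matrix_square_circulant:
  assumes size: "graph_size G > 0" and \<sigma>: "\<sigma> \<in> labelings G"
    and eq: "fourier_ratio (adj_matrix G \<sigma>) = graph_energy G / sqrt (2 * real (graph_size G))"
    and xy: "x < card (verts G)" "y < card (verts G)"
  shows "(adj_matrix G \<sigma> * adj_matrix G \<sigma>) $$ (Suc x mod card (verts G), Suc y mod card (verts G)) =
    (adj_matrix G \<sigma> * adj_matrix G \<sigma>) $$ (x, y)"
proof -
  let ?A = "adj_matrix G \<sigma>" and ?N = "card (verts G)"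
  let ?F = "fourier_matrix ?N"
  have A: "?A \<in> carrier_mat ?N ?N" by simp
  have F: "?F \<in> carrier_mat ?N ?N" by simp
  have "frobenius_norm (?F * ?A * ?F) = sqrt (2 * real (graph_size G))"
    unfolding frobenius_norm_unitary[OF A F fourier_matrix_unitary]
    by (rule frobenius_norm_adj_matrix[OF \<sigma>])
  moreover have "dim_row ?A = ?N" by (simp add: adj_matrix_def)
  \<comment> \<open>The positive size allows the common denominator to be cancelled; what remains is
    the equality case of the bound by the energy.\<close>
  ultimately have "l1_norm_mat (?F * ?A * ?F) = matrix_energy ?A"
    using eq size unfolding fourier_ratio_def Let_def graph_energy_labeling[OF \<sigma>] by simp
  then have "diagonal_mat (?F * (?A * ?A) * ctranspose ?F)"
    by (rule fourier_equality_diagonal[OF A adj_matrix_hermitian F fourier_matrix_unitary])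
  then show ?thesis
    by (rule fourier_diagonal_circulant[OF mult_carrier_mat[OF A A] _ xy])
qed

end

section \<open>Common neighbours and components\<close>

text \<open>Chains are carried forward by \<open>t\<close>. They can also be pulled back one step at
  a time, because \<open>t\<close> is onto \<open>V\<close> and \<open>inv\<close> is an
  equivalence.\<close>

lemma rtrancl_image_bij:
  assumes bij: "bij_betw t V V" and R: "R \<subseteq> V \<times> V"
    and inv: "\<And>a b. a \<in> V \<Longrightarrow> b \<in> V \<Longrightarrow> (t a, t b) \<in> R \<longleftrightarrow> (a, b) \<in> R"
    and a: "a \<in> V"
  shows "R\<^sup>* `` {t a} = t ` (R\<^sup>* `` {a})"
proof
  have in_V: "b \<in> V" if "(a, b) \<in> R\<^sup>*" "a \<in> V" for a b
    using that by (induction rule: rtrancl_induct) (use R in auto)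
  show "t ` (R\<^sup>* `` {a}) \<subseteq> R\<^sup>* `` {t a}"
  proof clarsimp
    fix b assume "(a, b) \<in> R\<^sup>*"
    then show "(t a, t b) \<in> R\<^sup>*"
    proof (induction rule: rtrancl_induct)
      case (step b c)
      then have "(t b, t c) \<in> R" using inv R by blast
      then show ?case using step.IH by simp
    qed simp
  qed
  show "R\<^sup>* `` {t a} \<subseteq> t ` (R\<^sup>* `` {a})"
  proof clarsimp
    fix c assume "(t a, c) \<in> R\<^sup>*"
    then show "c \<in> t ` (R\<^sup>* `` {a})"
    proof (induction rule: rtrancl_induct)
      case base
      then show ?case by blast
    next
      case (step c d)
      then obtain b where b: "c = t b" "(a, b) \<in> R\<^sup>*" by blast
      have "d \<in> V" using step.hyps R by blast
      then obtain e where e: "e \<in> V" "d = t e" using bij by (auto simp: bij_betw_def)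
      have "(b, e) \<in> R" using step.hyps(2) b e inv in_V[OF b(2) a] by simp
      then show ?case using b(2) e(2) by (meson ImageI rtrancl.rtrancl_into_rtrancl image_eqI singletonI)
    qed
  qed
qed

text \<open>In terms of labels this is the support of the squared adjacency matrix. It is symmetric,
  and \<open>(u, u)\<close> belongs to it exactly if \<open>u\<close> has a neighbour, so it also
  detects isolated vertices.\<close>

definition common_neighbour_rel :: "('a, 'b) pre_digraph \<Rightarrow> ('a \<times> 'a) set" where
  "common_neighbour_rel G = {(u, w). \<exists>z. u \<rightarrow>\<^bsub>G\<^esub> z \<and> w \<rightarrow>\<^bsub>G\<^esub> z}"

lemma cyclic_shift_all:
  assumes "S \<subseteq> {..<N::nat}" "S \<noteq> {}" "\<And>x. x \<in> S \<Longrightarrow> Suc x mod N \<in> S"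
  shows "S = {..<N}"
proof -
  obtain s where s: "s \<in> S" using assms(2) by blast
  have "(s + k) mod N \<in> S" for k
  proof (induction k)
    case 0
    then show ?case using s assms(1) by auto
  next
    case (Suc k)
    then show ?case using assms(3)[OF Suc] by (simp add: mod_Suc_eq)
  qed
  \<comment> \<open>The number of steps from \<open>s\<close> to \<open>y\<close> is
    \<open>N - s + y\<close>: first to the wrap-around at \<open>N\<close>, then on to
    \<open>y\<close>. The subtraction is not truncated, as \<open>s < N\<close>.\<close>
  moreover have "y = (s + (N - s + y)) mod N" if "y < N" for y
    using that s assms(1) by auto
  ultimately show ?thesis using assms(1) by (metis lessThan_iff subsetI subset_antisym)
qed

text \<open>The successor of labels, transported to the vertices as \<open>t\<close>, is an
  automorphism of the relation with a single orbit. Hence the size of a class and the existence of a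
  neighbour carry over from one vertex to all.\<close>

lemma circulant_common_neighbour_classes:
  assumes G: "graph G" and \<sigma>: "\<sigma> \<in> labelings G" and arcs: "arcs G \<noteq> {}"
    and shift: "\<And>u w u' w'. u \<in> verts G \<Longrightarrow> w \<in> verts G \<Longrightarrow> u' \<in> verts G \<Longrightarrow> w' \<in> verts G \<Longrightarrow>
      \<sigma> u' = Suc (\<sigma> u) mod card (verts G) \<Longrightarrow> \<sigma> w' = Suc (\<sigma> w) mod card (verts G) \<Longrightarrow>
      (u', w') \<in> common_neighbour_rel G \<longleftrightarrow> (u, w) \<in> common_neighbour_rel G"
  obtains v where "v > 0" "\<And>u. u \<in> verts G \<Longrightarrow> card ((common_neighbour_rel G)\<^sup>* `` {u}) = v"
    "\<And>u. u \<in> verts G \<Longrightarrow> \<exists>z. u \<rightarrow>\<^bsub>G\<^esub> z"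
proof -
  interpret graph G by fact
  let ?V = "verts G" and ?N = "card (verts G)" and ?R = "common_neighbour_rel G"
  have bij: "bij_betw \<sigma> ?V {..<?N}" using \<sigma> by (simp add: labelings_def)
  obtain e where e: "e \<in> arcs G" using arcs by blast
  then have "?V \<noteq> {}" using tail_in_verts by blast
  then have N: "?N > 0" by (simp add: card_gt_0_iff)
  define \<rho> where "\<rho> = inv_into ?V \<sigma>"
  have \<rho>: "\<sigma> (\<rho> x) = x" "\<rho> x \<in> ?V" if "x < ?N" for x
    using bij that by (auto simp: \<rho>_def bij_betw_def f_inv_into_f inv_into_into)
  have \<rho>\<sigma>: "\<rho> (\<sigma> u) = u" if "u \<in> ?V" for u
    using bij that by (simp add: \<rho>_def bij_betw_def)
  have \<sigma>_lt: "\<sigma> u < ?N" if "u \<in> ?V" for u using bij that by (auto simp: bij_betw_def)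
  define t where "t u = \<rho> (Suc (\<sigma> u) mod ?N)" for u
  have t: "t u \<in> ?V" "\<sigma> (t u) = Suc (\<sigma> u) mod ?N" for u
    using N \<rho> by (simp_all add: t_def)
  have R: "?R \<subseteq> ?V \<times> ?V" unfolding common_neighbour_rel_def by (auto dest: adj_in_verts)
  have inv: "(t a, t b) \<in> ?R \<longleftrightarrow> (a, b) \<in> ?R" if "a \<in> ?V" "b \<in> ?V" for a b
    using shift[OF that t(1) t(1) t(2) t(2)] .
  \<comment> \<open>Induction along the orbit of \<open>t\<close>: the labels of the vertices with
    property \<open>P\<close> are closed under the cyclic successor, hence exhaust all
    labels.\<close>
  have orbit: "P u" if "u \<in> ?V" "u0 \<in> ?V" "P u0" "\<And>w. w \<in> ?V \<Longrightarrow> P w \<Longrightarrow> P (t w)" for P u u0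
  proof -
    have "{x. x < ?N \<and> P (\<rho> x)} = {..<?N}"
    proof (rule cyclic_shift_all)
      show "{x. x < ?N \<and> P (\<rho> x)} \<noteq> {}" using that(2,3) \<sigma>_lt \<rho>\<sigma> by force
      fix x assume "x \<in> {x. x < ?N \<and> P (\<rho> x)}"
      then have "P (t (\<rho> x))" "x < ?N" using that(4) \<rho> by auto
      then show "Suc x mod ?N \<in> {x. x < ?N \<and> P (\<rho> x)}" using \<rho> N by (simp add: t_def)
    qed auto
    moreover have "\<sigma> u \<in> {..<?N}" using \<sigma>_lt[OF that(1)] by simp
    ultimately have "P (\<rho> (\<sigma> u))" by blast
    then show ?thesis using \<rho>\<sigma>[OF that(1)] by simp
  qed
  have "inj_on t ?V"
  proof (rule inj_onI)
    fix a b assume ab: "a \<in> ?V" "b \<in> ?V" "t a = t b"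
    then have "Suc (\<sigma> a) mod ?N = Suc (\<sigma> b) mod ?N"
      unfolding t(2)[symmetric] using ab(3) by simp
    then have "\<sigma> a = \<sigma> b" using \<sigma>_lt[OF ab(1)] \<sigma>_lt[OF ab(2)] by (auto simp: mod_Suc split: if_splits)
    then show "a = b" using \<rho>\<sigma> ab by metis
  qed
  moreover have "t ` ?V \<subseteq> ?V" using t by auto
  ultimately have tbij: "bij_betw t ?V ?V" by (simp add: bij_betw_def endo_inj_surj)
  let ?u0 = "tail G e"
  have u0: "?u0 \<in> ?V" using e by simp
  let ?K = "\<lambda>u. ?R\<^sup>* `` {u}"
  have K_sub: "?K u \<subseteq> ?V" if "u \<in> ?V" for u
  proof
    fix w assume "w \<in> ?K u"
    then have "(u, w) \<in> ?R\<^sup>*" by simp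
    then show "w \<in> ?V" by (induction rule: rtrancl_induct) (use R that in auto)
  qed
  have "card (?K u) = card (?K ?u0)" if "u \<in> ?V" for u
  proof (rule orbit[OF that u0])
    fix w assume w: "w \<in> ?V" "card (?K w) = card (?K ?u0)"
    have "card (?K (t w)) = card (t ` ?K w)"
      using rtrancl_image_bij[OF tbij R inv w(1)] by simp
    also have "\<dots> = card (?K w)"
      using \<open>inj_on t ?V\<close> K_sub[OF w(1)] by (intro card_image) (rule inj_on_subset)
    finally show "card (?K (t w)) = card (?K ?u0)" using w(2) by simp
  qed simp
  moreover have "card (?K ?u0) > 0"
    using finite_subset[OF K_sub[OF u0]] by (auto simp: card_gt_0_iff)
  moreover have "\<exists>z. u \<rightarrow>\<^bsub>G\<^esub> z" if "u \<in> ?V" for u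
  proof -
    \<comment> \<open>Having a neighbour is expressed through the relation, whose invariance is
      known; the adjacency itself need not be preserved by \<open>t\<close>.\<close>
    have "(u, u) \<in> ?R"
    proof (rule orbit[OF that u0])
      show "(?u0, ?u0) \<in> ?R" using in_arcs_imp_in_arcs_ends[OF e] by (auto simp: common_neighbour_rel_def)
    qed (use inv in auto)
    then show ?thesis by (auto simp: common_neighbour_rel_def)
  qed
  ultimately show ?thesis using that by blast
qed

section \<open>Components and their common-neighbour classes\<close>

text \<open>\<open>connected_component\<close> is given by maximality. The subgraph
  \<open>?D\<close> induced on the vertices reachable from \<open>u\<close> is connected and
  contains \<open>C\<close>, so maximality makes them equal.\<close>

lemma (in sym_digraph) connected_component_verts:
  assumes C: "connected_component G C" and u: "u \<in> verts C"
  shows "verts C = {w. u \<rightarrow>\<^sup>*\<^bsub>G\<^esub> w}" and "induced_subgraph C G"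
proof -
  have max: "max_subgraph connected C" using C by (simp add: connected_component_def)
  \<comment> \<open>Adding arcs on the same vertices preserves connectedness, so a maximal connected
    subgraph is induced.\<close>
  have mono: "arc_mono connected"
    unfolding arc_mono_def using wf_digraph.connected_spanning_imp_connected
    by (metis spanning_def subgraph_def)
  show ind: "induced_subgraph C G" by (rule induced_subgraphI_arc_mono[OF max mono])
  interpret C: wf_digraph C using ind by (rule wf_digraphI_induced)
  have "symmetric C" using sym_arcs ind by (rule induced_graph_imp_symmetric)
  \<comment> \<open>With symmetric arcs, connectedness already provides directed paths in both
    directions.\<close>
  then have sc: "strongly_connected C"
    using max by (intro C.symmetric_connected_imp_strongly_connected) (auto simp: max_subgraph_def)
  let ?D = "G \<restriction> {w. u \<rightarrow>\<^sup>*\<^bsub>G\<^esub> w}"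
  have "u \<in> verts G" using u ind by (auto dest: induced_imp_subgraph subgraph_imp_subverts)
  then have "?D \<in> sccs" by (rule induce_reachable_is_in_sccs)
  then have D: "strongly_connected ?D" "induced_subgraph ?D G" by (auto simp: sccs_def)
  have conn: "connected ?D"
    unfolding connected_conv
  proof (intro conjI ballI)
    show "verts ?D \<noteq> {}" using D(1) by (simp add: strongly_connected_def)
    fix a b assume "a \<in> verts ?D" "b \<in> verts ?D"
    then have "(a, b) \<in> rtrancl_on (verts ?D) (arcs_ends ?D)"
      using D(1) unfolding strongly_connected_def reachable_def by blast
    then show "(a, b) \<in> rtrancl_on (verts ?D) ((arcs_ends ?D)\<^sup>s)"
      by (rule rtrancl_on_mono[rotated 2]) (auto simp: symcl_def)
  qed
  have verts_sub: "verts C \<subseteq> verts ?D"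
  proof
    fix w assume "w \<in> verts C"
    then have "u \<rightarrow>\<^sup>*\<^bsub>C\<^esub> w" using sc u by (auto simp: strongly_connected_def)
    then have "u \<rightarrow>\<^sup>*\<^bsub>G\<^esub> w"
      using ind by (auto intro: pre_digraph.reachable_mono dest: induced_imp_subgraph)
    then show "w \<in> verts ?D" by simp
  qed
  have "subgraph C ?D"
    unfolding subgraph_def
  proof (intro conjI)
    show "verts C \<subseteq> verts ?D" by (rule verts_sub)
    then show "arcs C \<subseteq> arcs ?D" using ind by (auto simp: induced_subgraph_def)
    show "wf_digraph ?D" using D(2) by (rule wf_digraphI_induced)
    show "wf_digraph C" by (rule C.wf_digraph)
    show "compatible ?D C"
      using ind by (simp add: induced_subgraph_def subgraph_def compatible_def)
  qed
  moreover have "subgraph ?D G" using D(2) by (rule induced_imp_subgraph)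
  ultimately have "C = ?D" using conn max unfolding max_subgraph_def by metis
  then show "verts C = {w. u \<rightarrow>\<^sup>*\<^bsub>G\<^esub> w}" by (metis induce_subgraph_verts)
qed

text \<open>A component is covered by the class \<open>?K u\<close> and the set \<open>?L u\<close>
  of vertices with a neighbour in it. In a bipartite component the sides are single classes.
  Otherwise the two sets overlap, as they would form a bipartition, and the overlap makes the class
  swallow the whole component.\<close>

lemma component_size:
  assumes G: "graph G" and C: "connected_component G C"
    and card_K: "\<And>u. u \<in> verts G \<Longrightarrow> card ((common_neighbour_rel G)\<^sup>* `` {u}) = v"
    and nbr: "\<And>u. u \<in> verts G \<Longrightarrow> \<exists>z. u \<rightarrow>\<^bsub>G\<^esub> z"
  shows "(\<not> bipartite C \<and> card (verts C) = v) \<or>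
       (bipartite C \<and> card (verts C) = 2 * v \<and>
        (\<forall>X Y. bipartition C X Y \<longrightarrow> card X = v \<and> card Y = v))"
proof -
  interpret graph G by fact
  let ?R = "common_neighbour_rel G"
  have sym: "b \<rightarrow>\<^bsub>G\<^esub> a" if "a \<rightarrow>\<^bsub>G\<^esub> b" for a b using that by (rule graph_symmetric)
  have Rsym: "(b, a) \<in> ?R" if "(a, b) \<in> ?R" for a b
    using that by (auto simp: common_neighbour_rel_def)
  have R_I: "(a, b) \<in> ?R" if "a \<rightarrow>\<^bsub>G\<^esub> z" "z \<rightarrow>\<^bsub>G\<^esub> b" for a b z
    using that sym by (auto simp: common_neighbour_rel_def)
  have RsSym: "(b, a) \<in> ?R\<^sup>*" if "(a, b) \<in> ?R\<^sup>*" for a b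
    using that Rsym by (metis sym_rtrancl symD symI)
  \<comment> \<open>Neighbours of vertices in one class lie in one class again: the chain is shifted
    by passing through the common neighbour of each link.\<close>
  have R_nbr: "(a', b') \<in> ?R\<^sup>*" if "(a, b) \<in> ?R\<^sup>*" "a \<rightarrow>\<^bsub>G\<^esub> a'" "b \<rightarrow>\<^bsub>G\<^esub> b'" for a b a' b'
    using that
  proof (induction arbitrary: b' rule: rtrancl_induct)
    case base
    then show ?case using R_I sym by blast
  next
    case (step b c)
    obtain z where z: "b \<rightarrow>\<^bsub>G\<^esub> z" "c \<rightarrow>\<^bsub>G\<^esub> z"
      using step.hyps by (auto simp: common_neighbour_rel_def)
    have "(a', z) \<in> ?R\<^sup>*" using step.IH step.prems(1) z(1) by blast
    moreover have "(z, b') \<in> ?R" using R_I[of z c b'] sym z(2) step.prems(2) by blast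
    ultimately show ?case by simp
  qed
  have "max_subgraph connected C" using C by (simp add: connected_component_def)
  then have "verts C \<noteq> {}" and C_G: "verts C \<subseteq> verts G"
    by (auto simp: max_subgraph_def connected_conv subgraph_def)
  then obtain u where u: "u \<in> verts C" "u \<in> verts G" by blast
  have ind: "induced_subgraph C G" using connected_component_verts(2)[OF C u(1)] .
  have reach: "verts C = {w. x \<rightarrow>\<^sup>*\<^bsub>G\<^esub> w}" if "x \<in> verts C" for x
    using connected_component_verts(1)[OF C that] .
  have closed: "b \<in> verts C" if "a \<in> verts C" "a \<rightarrow>\<^bsub>G\<^esub> b" for a b
    using reach[OF that(1)] that(2) by auto
  have adj_C: "a \<rightarrow>\<^bsub>C\<^esub> b \<longleftrightarrow> a \<in> verts C \<and> b \<in> verts C \<and> a \<rightarrow>\<^bsub>G\<^esub> b" for a b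
  proof -
    have eqs: "tail C = tail G" "head C = head G"
      using ind by (simp_all add: induced_subgraph_def subgraph_def compatible_def)
    have "arcs C = {e \<in> arcs G. tail G e \<in> verts C \<and> head G e \<in> verts C}"
      using ind unfolding induced_subgraph_def by blast
    then show ?thesis unfolding arcs_ends_conv eqs by (auto simp: image_iff)
  qed
  let ?K = "\<lambda>x. ?R\<^sup>* `` {x}"
  have K_C: "?K x \<subseteq> verts C" if "x \<in> verts C" for x
  proof
    fix w assume "w \<in> ?K x"
    then have "(x, w) \<in> ?R\<^sup>*" by simp
    then show "w \<in> verts C"
    proof (induction rule: rtrancl_induct)
      case (step b c)
      then obtain z where "b \<rightarrow>\<^bsub>G\<^esub> z" "c \<rightarrow>\<^bsub>G\<^esub> z" by (auto simp: common_neighbour_rel_def)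
      then show ?case using step.IH closed sym by metis
    qed (rule that)
  qed
  let ?L = "\<lambda>x. {w. \<exists>z. w \<rightarrow>\<^bsub>G\<^esub> z \<and> z \<in> ?K x}"
  \<comment> \<open>Along a path from \<open>x\<close>, a step out of the class lands in
    \<open>?L x\<close>. A step from \<open>b\<close> in \<open>?L x\<close> lands in the class,
    since \<open>b\<close> is a common neighbour of its endpoint and of a class member.\<close>
  have KL: "w \<in> ?K x \<union> ?L x" if "x \<in> verts C" "w \<in> verts C" for x w
  proof -
    have "x \<rightarrow>\<^sup>*\<^bsub>G\<^esub> w" using that(2) unfolding reach[OF that(1)] by (rule CollectD)
    then have "(x, w) \<in> (arcs_ends G)\<^sup>*" by (rule reachable_rtranclI)
    then show ?thesis
    proof (induction rule: rtrancl_induct)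
      case (step b c)
      from step.IH show ?case
      proof (rule UnE)
        assume "b \<in> ?K x"
        then show ?thesis using sym[OF step.hyps(2)] by blast
      next
        assume "b \<in> ?L x"
        then obtain z where z: "b \<rightarrow>\<^bsub>G\<^esub> z" "(x, z) \<in> ?R\<^sup>*" by blast
        have "(z, c) \<in> ?R" using R_I[OF sym[OF z(1)] step.hyps(2)] .
        then have "(x, c) \<in> ?R\<^sup>*" using z(2) by simp
        then show ?thesis by blast
      qed
    qed blast
  qed
  have side: "card X = v" "Y \<noteq> {}" if bip: "X \<union> Y = verts C" "X \<inter> Y = {}"
      "\<And>a b. a \<rightarrow>\<^bsub>C\<^esub> b \<Longrightarrow> (a \<in> X \<and> b \<in> Y) \<or> (a \<in> Y \<and> b \<in> X)" and x: "x \<in> X" for X Y x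
  proof -
    have xC: "x \<in> verts C" using bip x by blast
    have cross: "b \<in> Y" if "a \<in> X" "a \<rightarrow>\<^bsub>G\<^esub> b" for a b
      using bip(3)[of a b] adj_C[of a b] closed[of a b] bip(1,2) that by blast
    have cross': "b \<in> X" if "a \<in> Y" "a \<rightarrow>\<^bsub>G\<^esub> b" for a b
      using bip(3)[of a b] adj_C[of a b] closed[of a b] bip(1,2) that by blast
    have KX: "?K x \<subseteq> X"
    proof
      fix w assume "w \<in> ?K x"
      then have "(x, w) \<in> ?R\<^sup>*" by simp
      then show "w \<in> X"
      proof (induction rule: rtrancl_induct)
        case (step b c)
        then obtain z where "b \<rightarrow>\<^bsub>G\<^esub> z" "c \<rightarrow>\<^bsub>G\<^esub> z" by (auto simp: common_neighbour_rel_def)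
        then show ?case using step.IH cross cross' sym by metis
      qed (rule x)
    qed
    have "X \<subseteq> ?K x"
    proof
      fix w assume w: "w \<in> X"
      \<comment> \<open>\<open>cross\<close> sends all neighbours of \<open>w\<close> to
        \<open>Y\<close>, whereas the class lies inside \<open>X\<close>.\<close>
      have "w \<notin> ?L x" using w cross KX bip(2) by blast
      then show "w \<in> ?K x" using KL[OF xC, of w] w bip(1) by blast
    qed
    then have "X = ?K x" using KX by blast
    then show "card X = v" using card_K[of x] xC C_G by auto
    \<comment> \<open>This excludes isolated vertices, whose bipartition would have an empty
      side.\<close>
    obtain z where "x \<rightarrow>\<^bsub>G\<^esub> z" using nbr[of x] xC C_G by blast
    then show "Y \<noteq> {}" using cross x by blast
  qed
  have sides: "card X = v \<and> card Y = v" if bip: "bipartition C X Y" for X Y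
  proof -
    have 1: "X \<union> Y = verts C" "X \<inter> Y = {}"
      "\<And>a b. a \<rightarrow>\<^bsub>C\<^esub> b \<Longrightarrow> (a \<in> X \<and> b \<in> Y) \<or> (a \<in> Y \<and> b \<in> X)"
      using bip unfolding bipartition_def by blast+
    \<comment> \<open>The roles of the sides are exchanged so that \<open>side\<close> also applies
      to \<open>Y\<close>.\<close>
    have 2: "Y \<union> X = verts C" "Y \<inter> X = {}"
      "\<And>a b. a \<rightarrow>\<^bsub>C\<^esub> b \<Longrightarrow> (a \<in> Y \<and> b \<in> X) \<or> (a \<in> X \<and> b \<in> Y)"
      using 1 by blast+
    have "X \<noteq> {} \<or> Y \<noteq> {}" using 1 u by blast
    then obtain x y where "x \<in> X" "y \<in> Y" using side(2)[OF 1] side(2)[OF 2] by blast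
    then show ?thesis using side(1)[OF 1] side(1)[OF 2] by blast
  qed
  show ?thesis
  proof (cases "bipartite C")
    case True
    then obtain X Y where XY: "bipartition C X Y" unfolding bipartite_def by (elim exE)
    then have un: "X \<union> Y = verts C" "X \<inter> Y = {}" by (simp_all add: bipartition_def)
    have "finite (X \<union> Y)" unfolding un by (rule finite_subset[OF C_G finite_verts])
    then have "card (X \<union> Y) = card X + card Y" using un(2) by (simp add: card_Un_disjoint)
    then have "card (verts C) = 2 * v" using sides[OF XY] un(1) by simp
    then show ?thesis using True sides by blast
  next
    case False
    have "?K u \<inter> ?L u \<noteq> {}"
    proof
      assume disj: "?K u \<inter> ?L u = {}"
      have "?L u \<subseteq> verts C" using K_C[OF u(1)] closed sym by blast
      then have "?K u \<union> ?L u = verts C" using KL[OF u(1)] K_C[OF u(1)] by blast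
      moreover have "(a \<in> ?K u \<and> b \<in> ?L u) \<or> (a \<in> ?L u \<and> b \<in> ?K u)" if ab: "a \<rightarrow>\<^bsub>C\<^esub> b" for a b
      proof -
        have ab: "a \<in> verts C" "b \<in> verts C" "a \<rightarrow>\<^bsub>G\<^esub> b" using ab adj_C by auto
        show ?thesis
        proof (cases "a \<in> ?K u")
          case True
          then have "b \<in> ?L u" using sym[OF ab(3)] by blast
          then show ?thesis using True by blast
        next
          case False
          then have aL: "a \<in> ?L u" using KL[OF u(1) ab(1)] by blast
          then obtain z where z: "a \<rightarrow>\<^bsub>G\<^esub> z" "(u, z) \<in> ?R\<^sup>*" by blast
          have "(z, b) \<in> ?R" using R_I[OF sym[OF z(1)] ab(3)] .
          then have "(u, b) \<in> ?R\<^sup>*" using z(2) by simp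
          then have "b \<in> ?K u" by simp
          then show ?thesis using aL by blast
        qed
      qed
      ultimately have "bipartition C (?K u) (?L u)" using disj unfolding bipartition_def by blast
      then show False using False unfolding bipartite_def by blast
    qed
    \<comment> \<open>The overlap provides an edge from \<open>w\<close> to \<open>z\<close> with
      both ends in the class of \<open>u\<close>.\<close>
    then obtain w z where w: "(u, w) \<in> ?R\<^sup>*" "w \<rightarrow>\<^bsub>G\<^esub> z" "(u, z) \<in> ?R\<^sup>*" by blast
    have "b \<in> ?K u" if "b \<in> ?L u" for b
    proof -
      obtain z' where z': "b \<rightarrow>\<^bsub>G\<^esub> z'" "(u, z') \<in> ?R\<^sup>*" using \<open>b \<in> ?L u\<close> by blast
      \<comment> \<open>\<open>z\<close> and \<open>z'\<close> lie in one class, so by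
        \<open>R_nbr\<close> their neighbours \<open>w\<close> and \<open>b\<close> do too, and
        \<open>w\<close> is in the class of \<open>u\<close>.\<close>
      have "(z, z') \<in> ?R\<^sup>*" using RsSym[OF w(3)] z'(2) by (rule rtrancl_trans)
      then have "(w, b) \<in> ?R\<^sup>*" using R_nbr sym w(2) z'(1) by blast
      then have "(u, b) \<in> ?R\<^sup>*" using w(1) by (meson rtrancl_trans)
      then show ?thesis by simp
    qed
    then have "verts C = ?K u" using KL[OF u(1)] K_C[OF u(1)] by blast
    then show ?thesis using False card_K[OF u(2)] by simp
  qed
qed

theorem proposition2p13:
  fixes G :: "('a, 'b) pre_digraph"
  assumes "graph G"
    and "graph_size G > 0"
    and "edge_complexity G = graph_energy G / sqrt (2 * real (graph_size G))"
  shows "\<exists>v::nat. v > 0 \<and>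
    (\<forall>C. connected_component G C \<longrightarrow>
       (\<not> bipartite C \<and> card (verts C) = v) \<or>
       (bipartite C \<and> card (verts C) = 2 * v \<and>
        (\<forall>X Y. bipartition C X Y \<longrightarrow> card X = v \<and> card Y = v)))"
proof -
  interpret graph G by fact
  let ?N = "card (verts G)" and ?R = "common_neighbour_rel G"
  \<comment> \<open>The minimum is attained, so the hypothesis turns into an equality for one
    optimal labeling.\<close>
  have "edge_complexity G \<in> (\<lambda>\<sigma>. fourier_ratio (adj_matrix G \<sigma>)) ` labelings G"
    unfolding edge_complexity_def
    by (intro Min_in finite_fourier_ratios) (simp add: labelings_nonempty)
  then obtain \<sigma> where \<sigma>: "\<sigma> \<in> labelings G"
    and eq: "fourier_ratio (adj_matrix G \<sigma>) = graph_energy G / sqrt (2 * real (graph_size G))"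
    using assms(3) by auto
  let ?B = "adj_matrix G \<sigma> * adj_matrix G \<sigma>"
  have rel: "(u, w) \<in> ?R \<longleftrightarrow> ?B $$ (\<sigma> u, \<sigma> w) \<noteq> 0" if "u \<in> verts G" "w \<in> verts G" for u w
    using adj_matrix_square_nonzero[OF \<sigma> that] by (simp add: common_neighbour_rel_def)
  have lt: "\<sigma> u < ?N" if "u \<in> verts G" for u
    using \<sigma> that by (auto simp: labelings_def bij_betw_def)
  \<comment> \<open>Membership in the relation is read off from the squared adjacency matrix, which
    does not change when both labels advance by one.\<close>
  have shift: "(u', w') \<in> ?R \<longleftrightarrow> (u, w) \<in> ?R"
    if "u \<in> verts G" "w \<in> verts G" "u' \<in> verts G" "w' \<in> verts G"
      "\<sigma> u' = Suc (\<sigma> u) mod ?N" "\<sigma> w' = Suc (\<sigma> w) mod ?N" for u w u' w'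
    unfolding rel[OF that(1,2)] rel[OF that(3,4)] that(5,6)
    by (simp only: adj_matrix_square_circulant[OF assms(2) \<sigma> eq lt[OF that(1)] lt[OF that(2)]])
  have arcs: "arcs G \<noteq> {}" using assms(2) by (auto simp: graph_size_def)
  show ?thesis
  proof (rule circulant_common_neighbour_classes[OF assms(1) \<sigma> arcs])
    fix u w u' w'
    assume "u \<in> verts G" "w \<in> verts G" "u' \<in> verts G" "w' \<in> verts G"
      "\<sigma> u' = Suc (\<sigma> u) mod ?N" "\<sigma> w' = Suc (\<sigma> w) mod ?N"
    then show "(u', w') \<in> ?R \<longleftrightarrow> (u, w) \<in> ?R" by (rule shift)
  next
    fix v
    assume v: "v > 0" and classes: "\<And>u. u \<in> verts G \<Longrightarrow> card (?R\<^sup>* `` {u}) = v"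
      and nbr: "\<And>u. u \<in> verts G \<Longrightarrow> \<exists>z. u \<rightarrow>\<^bsub>G\<^esub> z"
    from v component_size[OF assms(1) _ classes nbr] show ?thesis by blast
  qed
qed

end
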